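(* Let $H\in C(\mathbb{R})$ with $H(0)=0$. Let $(a,b)$, $-\infty\le a<0<b\le+\infty$, be the maximal neighborhood of zero on which $H$ is linear, i.e. $H(u)=cu$ on $(a,b)$ for some $c\in\mathbb{R}$; if no such interval exists (that is, $H$ is not linear in any vicinity of zero), set $a=b=0$. Let $u_0\in C(\mathbb{T})$, and let $u(t,x)$ be the unique viscosity solution of the Cauchy problem $$u_t+H(u_x)=0 \ \text{ in } \Pi=(0,+\infty)\times\mathbb{R},\qquad u(0,x)=u_0(x).$$ Then there exist a continuous periodic function $p(y)\in C(\mathbb{T})$ and a real constant $c$ such that $$u(t,x)-p(x-ct)\to 0 \quad\text{uniformly in } x \text{ as } t\to+\infty.$$ Moreover, the profile $p$ satisfies the one-sided Lipschitz estimates $$a(y_2-y_1)\le p(y_2)-p(y_1)\le b(y_2-y_1)\qquad \forall y_1,y_2\in\mathbb{R},\ y_2>y_1,$$ while the speed $c$ is determined by the condition that $H(u)=cu$ on $(a,b)$. In the case $a=b=0$ it follows that $p(y)\equiv p_0=\mathrm{const}$, and the convergence reduces to the decay property $$u(t,x)\to p_0\quad\text{uniformly in } x \text{ as } t\to+\infty$$ (in this case the value of $c$ does not matter).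
   Context: $\mathbb{T}=\mathbb{R}/\mathbb{Z}$; $C(\mathbb{T})$ is the space of continuous real functions on $\mathbb{R}$ that are periodic with period $1$. If $a=-\infty$ (respectively $b=+\infty$), the corresponding inequality in the one-sided Lipschitz estimates is void. $BUC_{loc}(\bar\Pi)$, $\bar\Pi=[0,+\infty)\times\mathbb{R}$, is the space of continuous functions on $\bar\Pi$ that are bounded and uniformly continuous in each layer $[0,T)\times\mathbb{R}$, $T>0$. Viscosity solutions. For $u\in C(\Pi)$, $D^+u(t_0,x_0)$ (respectively $D^-u(t_0,x_0)$) is the set of all vectors $\nabla\varphi(t_0,x_0)=(\varphi_t(t_0,x_0),\varphi_x(t_0,x_0))$ where $\varphi\in C^1(\Pi)$ and $(t_0,x_0)$ is a point of local maximum (respectively local minimum) of $u-\varphi$. A function $u\in BUC_{loc}(\bar\Pi)$ is a viscosity subsolution of the problem $u_t+H(u_x)=0$, $u(0,x)=u_0(x)$ if $u(0,x)\le u_0(x)$ for all $x$ and $s+H(p)\le 0$ for all $(s,p)\in D^+u(t,x)$, $(t,x)\in\Pi$; it is a viscosity supersolution if $u(0,x)\ge u_0(x)$ for all $x$ and $s+H(p)\ge 0$ for all $(s,p)\in D^-u(t,x)$, $(t,x)\in\Pi$; it is a viscosity solution if it is both. It is known that for each bounded uniformly continuous $u_0$ there is a unique viscosity solution. *)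

theory Defs
  imports "HOL-Analysis.Analysis"
begin

definition periodic_continuous :: "(real \<Rightarrow> real) set" where
  "periodic_continuous = {f. continuous_on UNIV f \<and> (\<forall>x. f (x + 1) = f x)}"

text \<open>Points of the half-plane are pairs \<open>(t, x)\<close> with the time variable first.
  A function on the open or closed half-plane is a total function on the plane whose
  remaining values are irrelevant.\<close>

definition half_plane :: "(real \<times> real) set" where
  "half_plane = {0<..} \<times> UNIV"

definition closed_half_plane :: "(real \<times> real) set" where
  "closed_half_plane = {0..} \<times> UNIV"

definition BUC_loc :: "(real \<times> real \<Rightarrow> real) set" where
  "BUC_loc = {u. continuous_on closed_half_plane u \<and>
     (\<forall>T>0. bounded (u ` ({0..<T} \<times> UNIV)) \<and> uniformly_continuous_on ({0..<T} \<times> UNIV) u)}"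

definition C1_half_plane ::
  "(real \<times> real \<Rightarrow> real) \<Rightarrow> (real \<times> real \<Rightarrow> real) \<Rightarrow> (real \<times> real \<Rightarrow> real) \<Rightarrow> bool" where
  "C1_half_plane \<phi> \<phi>t \<phi>x \<longleftrightarrow>
     continuous_on half_plane \<phi>t \<and> continuous_on half_plane \<phi>x \<and>
     (\<forall>z\<in>half_plane. (\<phi> has_derivative (\<lambda>(h, k). \<phi>t z * h + \<phi>x z * k)) (at z))"

text \<open>Both sets below are used only at points of the (open) half-plane, so that local extrema
  relative to the half-plane and relative to the plane coincide.\<close>

definition superdifferential :: "(real \<times> real \<Rightarrow> real) \<Rightarrow> real \<times> real \<Rightarrow> (real \<times> real) set" where
  "superdifferential u z = {(\<phi>t z, \<phi>x z) | \<phi> \<phi>t \<phi>x.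
     C1_half_plane \<phi> \<phi>t \<phi>x \<and> (\<forall>\<^sub>F w in nhds z. u w - \<phi> w \<le> u z - \<phi> z)}"

definition subdifferential :: "(real \<times> real \<Rightarrow> real) \<Rightarrow> real \<times> real \<Rightarrow> (real \<times> real) set" where
  "subdifferential u z = {(\<phi>t z, \<phi>x z) | \<phi> \<phi>t \<phi>x.
     C1_half_plane \<phi> \<phi>t \<phi>x \<and> (\<forall>\<^sub>F w in nhds z. u z - \<phi> z \<le> u w - \<phi> w)}"

definition viscosity_subsolution ::
  "(real \<Rightarrow> real) \<Rightarrow> (real \<Rightarrow> real) \<Rightarrow> (real \<times> real \<Rightarrow> real) \<Rightarrow> bool" where
  "viscosity_subsolution H u0 u \<longleftrightarrow> u \<in> BUC_loc \<and> (\<forall>x. u (0, x) \<le> u0 x) \<and>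
     (\<forall>z\<in>half_plane. \<forall>(s, p)\<in>superdifferential u z. s + H p \<le> 0)"

definition viscosity_supersolution ::
  "(real \<Rightarrow> real) \<Rightarrow> (real \<Rightarrow> real) \<Rightarrow> (real \<times> real \<Rightarrow> real) \<Rightarrow> bool" where
  "viscosity_supersolution H u0 u \<longleftrightarrow> u \<in> BUC_loc \<and> (\<forall>x. u (0, x) \<ge> u0 x) \<and>
     (\<forall>z\<in>half_plane. \<forall>(s, p)\<in>subdifferential u z. s + H p \<ge> 0)"

definition viscosity_solution ::
  "(real \<Rightarrow> real) \<Rightarrow> (real \<Rightarrow> real) \<Rightarrow> (real \<times> real \<Rightarrow> real) \<Rightarrow> bool" where
  "viscosity_solution H u0 u \<longleftrightarrow> viscosity_subsolution H u0 u \<and> viscosity_supersolution H u0 u"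

definition linear_between :: "(real \<Rightarrow> real) \<Rightarrow> real \<Rightarrow> ereal \<Rightarrow> ereal \<Rightarrow> bool" where
  "linear_between H c a b \<longleftrightarrow> (\<forall>v. a < ereal v \<and> ereal v < b \<longrightarrow> H v = c * v)"

text \<open>Two intervals around zero on which \<open>H\<close> is linear overlap near zero, so they share the slope
  and their union is again such an interval; hence maximal means largest.\<close>

definition maximal_linear_nbhd :: "(real \<Rightarrow> real) \<Rightarrow> ereal \<Rightarrow> ereal \<Rightarrow> bool" where
  "maximal_linear_nbhd H a b \<longleftrightarrow>
     a < 0 \<and> 0 < b \<and> (\<exists>c. linear_between H c a b) \<and>
     (\<forall>a' b' c'. a' < 0 \<and> 0 < b' \<and> linear_between H c' a' b' \<longrightarrow> a \<le> a' \<and> b' \<le> b)"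

definition linearity_bounds :: "(real \<Rightarrow> real) \<Rightarrow> ereal \<Rightarrow> ereal \<Rightarrow> bool" where
  "linearity_bounds H a b \<longleftrightarrow>
     maximal_linear_nbhd H a b \<or>
     (\<nexists>a' b' c'. a' < 0 \<and> 0 < b' \<and> linear_between H c' a' b') \<and> a = 0 \<and> b = 0"

text \<open>The product is taken in the extended reals: for \<open>y1 < y2\<close> an infinite bound makes the
  corresponding inequality trivially true.\<close>

definition one_sided_Lipschitz :: "ereal \<Rightarrow> ereal \<Rightarrow> (real \<Rightarrow> real) \<Rightarrow> bool" where
  "one_sided_Lipschitz a b p \<longleftrightarrow>
     (\<forall>y1 y2. y1 < y2 \<longrightarrow>
        a * ereal (y2 - y1) \<le> ereal (p y2 - p y1) \<and>
        ereal (p y2 - p y1) \<le> b * ereal (y2 - y1))"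

end

theory Submission
  imports Defs "HOL-Complex_Analysis.Great_Picard" "HOL-Library.Periodic_Fun"
begin

text \<open>The proof rests on order preservation alone. By \<open>comparison_principle\<close> the evolution is a contraction
for the supremum norm that commutes with translations. So the orbit is equicontinuous and periodic, and
\<open>u (t, x + c * t)\<close> converges uniformly to some periodic \<open>p\<close> along a sequence of times (\<open>limit_profile\<close>). Once the
slopes of \<open>p\<close> are known to lie in \<open>[a, b]\<close>, where \<open>H q = c * q\<close>, the travelling wave \<open>p (x - c * t)\<close> is a
viscosity solution itself (\<open>travelling_wave_solution\<close>), and the contraction property turns convergence
along a sequence into convergence for all times (\<open>wave_distance_propagates\<close>).

The heart of the matter is therefore the bound on the slopes of \<open>p\<close>. If the mean slope of \<open>p\<close> over some interval
of length \<open>h\<close> is larger than \<open>b\<close>, then the same holds for \<open>u\<close> at every time, because a bound on the increments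
over the distance \<open>h\<close> would propagate to all later times (\<open>profile_increment_persists\<close>). It is shown that
increments of mean slope above some \<open>K > 0\<close> can persist only if \<open>H\<close> is linear on \<open>[- s, K]\<close> for some \<open>s > 0\<close>
(\<open>persistent_slope_imp_linear\<close>); with \<open>K > b\<close> this contradicts the maximality of the interval. The lower
bound follows by reflection in space.

Persistence is exploited by following crossings of \<open>u\<close> with the affine solutions \<open>k * x - H k * t + const\<close>. Since
\<open>u\<close> is bounded, such crossings happen near a point that moves with speed \<open>H k / k\<close>. Let \<open>0 < k < l \<le> K\<close> and let
\<open>H\<close> lie below its chord on \<open>[k, l]\<close>. Then the minimum of two affine solutions with slopes \<open>k\<close> and \<open>l\<close>, suitably
smoothed, is a subsolution. By the maximum principle, a point where \<open>u\<close> is below this hat and a point on its right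
where \<open>u\<close> is above the line of slope \<open>l\<close> have predecessors, in the same order, at all earlier times
(\<open>ordered_triple_trace_back\<close>). As there are such pairs at arbitrarily late times, the order of the points forces
\<open>H l / l \<le> H k / k\<close>, that is, the chord meets the vertical axis at a nonnegative height
(\<open>chord_intercept_nonneg\<close>). Applied to \<open>- u (t, - x)\<close> the argument yields the opposite inequality for chords
below the graph of \<open>H\<close>. A continuous function with \<open>H 0 = 0\<close> that has both properties is linear on \<open>[0, K]\<close>
(\<open>slopes_from_origin_antimono\<close>). For negative slopes reflection in space is used, and a variant with lines of
slopes of opposite signs (\<open>chord_intercept_nonpos\<close>) shows that there is no kink at zero.\<close>

section \<open>Viscosity inequalities and their symmetries\<close>

text \<open>The differential inequalities are separated from the initial condition, since the former are what
the symmetries of the equation act on.\<close>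

definition visc_sub :: "(real \<Rightarrow> real) \<Rightarrow> (real \<times> real \<Rightarrow> real) \<Rightarrow> bool" where
  "visc_sub H u \<longleftrightarrow> (\<forall>z\<in>half_plane. \<forall>(s, p)\<in>superdifferential u z. s + H p \<le> 0)"

definition visc_super :: "(real \<Rightarrow> real) \<Rightarrow> (real \<times> real \<Rightarrow> real) \<Rightarrow> bool" where
  "visc_super H u \<longleftrightarrow> (\<forall>z\<in>half_plane. \<forall>(s, p)\<in>subdifferential u z. s + H p \<ge> 0)"

lemma visc_subD:
  assumes "visc_sub H u" "C1_half_plane \<phi> \<phi>t \<phi>x" "z \<in> half_plane"
    and "\<forall>\<^sub>F w in nhds z. u w - \<phi> w \<le> u z - \<phi> z"
  shows "\<phi>t z + H (\<phi>x z) \<le> 0"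
proof -
  have "(\<phi>t z, \<phi>x z) \<in> superdifferential u z"
    using assms unfolding superdifferential_def by blast
  then show ?thesis using assms(1,3) unfolding visc_sub_def by auto
qed

lemma visc_subI:
  assumes "\<And>\<phi> \<phi>t \<phi>x z. C1_half_plane \<phi> \<phi>t \<phi>x \<Longrightarrow> z \<in> half_plane \<Longrightarrow>
      \<forall>\<^sub>F w in nhds z. u w - \<phi> w \<le> u z - \<phi> z \<Longrightarrow> \<phi>t z + H (\<phi>x z) \<le> 0"
  shows "visc_sub H u"
  unfolding visc_sub_def superdifferential_def using assms by auto

lemma visc_superD:
  assumes "visc_super H u" "C1_half_plane \<phi> \<phi>t \<phi>x" "z \<in> half_plane"
    and "\<forall>\<^sub>F w in nhds z. u z - \<phi> z \<le> u w - \<phi> w"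
  shows "\<phi>t z + H (\<phi>x z) \<ge> 0"
proof -
  have "(\<phi>t z, \<phi>x z) \<in> subdifferential u z"
    using assms unfolding subdifferential_def by blast
  then show ?thesis using assms(1,3) unfolding visc_super_def by auto
qed

lemma C1_half_plane_uminus:
  assumes "C1_half_plane \<phi> \<phi>t \<phi>x"
  shows "C1_half_plane (\<lambda>z. - \<phi> z) (\<lambda>z. - \<phi>t z) (\<lambda>z. - \<phi>x z)"
  using assms unfolding C1_half_plane_def
  by (auto intro!: continuous_intros derivative_eq_intros simp: case_prod_unfold)

lemma superdifferential_uminus:
  "superdifferential (\<lambda>z. - u z) z = (\<lambda>(s, p). (- s, - p)) ` subdifferential u z"
proof (intro equalityI subsetI)
  fix q assume "q \<in> superdifferential (\<lambda>z. - u z) z"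
  then obtain \<phi> \<phi>t \<phi>x where q: "q = (\<phi>t z, \<phi>x z)" and 1: "C1_half_plane \<phi> \<phi>t \<phi>x"
    and 2: "\<forall>\<^sub>F w in nhds z. - u w - \<phi> w \<le> - u z - \<phi> z"
    unfolding superdifferential_def by auto
  have "(- \<phi>t z, - \<phi>x z) \<in> subdifferential u z"
    unfolding subdifferential_def using C1_half_plane_uminus[OF 1]
      eventually_mono[OF 2, of "\<lambda>w. u z - (- \<phi> z) \<le> u w - (- \<phi> w)"] by fastforce
  then show "q \<in> (\<lambda>(s, p). (- s, - p)) ` subdifferential u z"
    unfolding q by force
next
  fix q assume "q \<in> (\<lambda>(s, p). (- s, - p)) ` subdifferential u z"
  then obtain \<phi> \<phi>t \<phi>x where q: "q = (- \<phi>t z, - \<phi>x z)" and 1: "C1_half_plane \<phi> \<phi>t \<phi>x"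
    and 2: "\<forall>\<^sub>F w in nhds z. u z - \<phi> z \<le> u w - \<phi> w"
    unfolding subdifferential_def by auto
  show "q \<in> superdifferential (\<lambda>z. - u z) z"
    unfolding superdifferential_def q using C1_half_plane_uminus[OF 1]
      eventually_mono[OF 2, of "\<lambda>w. - u w - (- \<phi> w) \<le> - u z - (- \<phi> z)"] by fastforce
qed

text \<open>Replacing \<open>u\<close> by \<open>- u\<close> exchanges the two kinds of one-sided differentials, so every statement on
subsolutions has a twin on supersolutions with the Hamiltonian \<open>\<lambda>p. - H (- p)\<close>.\<close>

lemma visc_sub_uminus_iff:
  "visc_sub (\<lambda>p. - H (- p)) (\<lambda>z. - u z) \<longleftrightarrow> visc_super H u"
  unfolding visc_sub_def visc_super_def superdifferential_uminus by (fastforce simp: case_prod_unfold)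

lemma visc_super_uminus_iff:
  "visc_super (\<lambda>p. - H (- p)) (\<lambda>z. - u z) \<longleftrightarrow> visc_sub H u"
  using visc_sub_uminus_iff[of "\<lambda>p. - H (- p)" "\<lambda>z. - u z"] by simp

text \<open>The condition on \<open>\<sigma>\<close> leaves the values \<open>1\<close> and \<open>- 1\<close>: translations in space and reflections. A test
function is carried over by the inverse map, which preserves the half-plane.\<close>

lemma visc_sub_affine:
  assumes u: "visc_sub H u" and \<sigma>: "\<sigma> * \<sigma> = (1::real)"
  shows "visc_sub (\<lambda>p. H (\<sigma> * p)) (\<lambda>(t, x). u (t, \<sigma> * x + h))"
proof (rule visc_subI)
  fix \<phi> \<phi>t \<phi>x and z :: "real \<times> real"
  assume 1: "C1_half_plane \<phi> \<phi>t \<phi>x" and z: "z \<in> half_plane"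
    and 2: "\<forall>\<^sub>F w in nhds z. (case w of (t, x) \<Rightarrow> u (t, \<sigma> * x + h)) - \<phi> w
              \<le> (case z of (t, x) \<Rightarrow> u (t, \<sigma> * x + h)) - \<phi> z"
  define B where "B = (\<lambda>w::real \<times> real. (fst w, \<sigma> * (snd w - h)))"
  define z' where "z' = (fst z, \<sigma> * snd z + h)"
  have Bz: "B z' = z" using \<sigma> by (simp add: B_def z'_def algebra_simps flip: mult.assoc)
  have AB: "(case B w of (t, x) \<Rightarrow> u (t, \<sigma> * x + h)) = u w" for w
    using \<sigma> by (cases w) (simp add: B_def flip: mult.assoc)
  have contB: "continuous_on S B" for S unfolding B_def by (intro continuous_intros)
  have Bh: "B w \<in> half_plane" if "w \<in> half_plane" for w
    using that by (auto simp: half_plane_def B_def)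
  have z'h: "z' \<in> half_plane" using z by (auto simp: half_plane_def z'_def)
  have "isCont B z'" unfolding B_def by (intro continuous_intros)
  have lim: "filterlim B (nhds z) (nhds z')"
    using \<open>isCont B z'\<close> by (metis Bz isCont_def tendsto_at_iff_tendsto_nhds)
  have "C1_half_plane (\<phi> \<circ> B) (\<phi>t \<circ> B) (\<lambda>w. \<sigma> * \<phi>x (B w))"
    unfolding C1_half_plane_def
  proof (intro conjI ballI)
    show "continuous_on half_plane (\<phi>t \<circ> B)"
      using 1 Bh unfolding C1_half_plane_def
      by (intro continuous_on_compose contB) (auto intro: continuous_on_subset)
    have "continuous_on half_plane (\<phi>x \<circ> B)"
      using 1 Bh unfolding C1_half_plane_def
      by (intro continuous_on_compose contB) (auto intro: continuous_on_subset)
    then show "continuous_on half_plane (\<lambda>w. \<sigma> * \<phi>x (B w))"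
      by (auto intro!: continuous_intros simp: o_def)
  next
    fix w assume w: "w \<in> half_plane"
    have d: "(\<phi> has_derivative (\<lambda>(h, k). \<phi>t (B w) * h + \<phi>x (B w) * k)) (at (B w))"
      using 1 Bh[OF w] unfolding C1_half_plane_def by blast
    have "(B has_derivative (\<lambda>(h, k). (h, \<sigma> * k))) (at w)"
      unfolding B_def by (auto intro!: derivative_eq_intros simp: case_prod_unfold)
    from diff_chain_at[OF this d]
    show "(\<phi> \<circ> B has_derivative (\<lambda>(h, k). (\<phi>t \<circ> B) w * h + \<sigma> * \<phi>x (B w) * k)) (at w)"
      by (rule has_derivative_eq_rhs) (auto simp: fun_eq_iff)
  qed
  moreover have "\<forall>\<^sub>F w in nhds z'. u w - (\<phi> \<circ> B) w \<le> u z' - (\<phi> \<circ> B) z'"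
  proof -
    have "\<forall>\<^sub>F w in nhds z'. (case B w of (t, x) \<Rightarrow> u (t, \<sigma> * x + h)) - \<phi> (B w)
              \<le> (case z of (t, x) \<Rightarrow> u (t, \<sigma> * x + h)) - \<phi> z"
      using eventually_compose_filterlim[OF 2 lim] .
    then show ?thesis unfolding AB Bz[symmetric] by (simp add: o_def)
  qed
  ultimately have "(\<phi>t \<circ> B) z' + H (\<sigma> * \<phi>x (B z')) \<le> 0"
    using visc_subD[OF u _ z'h] by blast
  then show "\<phi>t z + H (\<sigma> * \<phi>x z) \<le> 0" by (simp add: Bz)
qed

lemma visc_super_affine:
  assumes u: "visc_super H u" and \<sigma>: "\<sigma> * \<sigma> = (1::real)"
  shows "visc_super (\<lambda>p. H (\<sigma> * p)) (\<lambda>(t, x). u (t, \<sigma> * x + h))"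
  using visc_sub_affine[OF u[folded visc_sub_uminus_iff] \<sigma>, of h]
  by (simp add: case_prod_unfold flip: visc_sub_uminus_iff)

section \<open>A maximum principle against smooth functions\<close>

lemma C1_half_planeI:
  assumes "continuous_on UNIV \<phi>t" "continuous_on UNIV \<phi>x"
    and "\<And>z. (\<phi> has_derivative (\<lambda>(h, k). \<phi>t z * h + \<phi>x z * k)) (at z)"
  shows "C1_half_plane \<phi> \<phi>t \<phi>x"
  using assms unfolding C1_half_plane_def by (auto intro: continuous_on_subset)

lemma C1_half_plane_add:
  assumes "C1_half_plane \<phi> \<phi>t \<phi>x" "C1_half_plane \<psi> \<psi>t \<psi>x"
  shows "C1_half_plane (\<lambda>z. \<phi> z + \<psi> z) (\<lambda>z. \<phi>t z + \<psi>t z) (\<lambda>z. \<phi>x z + \<psi>x z)"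
proof -
  have "((\<lambda>z. \<phi> z + \<psi> z) has_derivative (\<lambda>(h, k). (\<phi>t z + \<psi>t z) * h + (\<phi>x z + \<psi>x z) * k)) (at z)"
    if "z \<in> half_plane" for z
  proof (rule has_derivative_eq_rhs)
    show "((\<lambda>z. \<phi> z + \<psi> z) has_derivative
        (\<lambda>w. (\<lambda>(h, k). \<phi>t z * h + \<phi>x z * k) w + (\<lambda>(h, k). \<psi>t z * h + \<psi>x z * k) w)) (at z)"
      using assms that unfolding C1_half_plane_def by (intro has_derivative_add) blast+
  qed (auto simp: fun_eq_iff algebra_simps)
  then show ?thesis
    using assms unfolding C1_half_plane_def by (auto intro!: continuous_on_add)
qed

lemma C1_half_plane_exp:
  "C1_half_plane (\<lambda>z. \<eta> * exp (M * (fst z - r))) (\<lambda>z. \<eta> * M * exp (M * (fst z - r))) (\<lambda>z. 0)"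
  by (rule C1_half_planeI)
    (auto intro!: continuous_intros derivative_eq_intros simp: fun_eq_iff algebra_simps)

lemma continuous_less_nbhd:
  fixes g :: "real \<Rightarrow> real"
  assumes "continuous_on {0..} g" "0 \<le> t" "g t < m"
  obtains \<tau> where "\<tau> > 0" "\<And>r. 0 \<le> r \<Longrightarrow> \<bar>r - t\<bar> \<le> \<tau> \<Longrightarrow> g r < m"
proof -
  obtain d where "d > 0" and d: "\<And>r. 0 \<le> r \<Longrightarrow> dist r t < d \<Longrightarrow> dist (g r) (g t) < m - g t"
    using assms(1)[unfolded continuous_on_iff, rule_format, of t "m - g t"] assms by auto
  show thesis
  proof (rule that[of "d / 2"])
    fix r :: real assume "0 \<le> r" "\<bar>r - t\<bar> \<le> d / 2"
    then show "g r < m" using d[of r] \<open>d > 0\<close> by (auto simp: dist_real_def)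
  qed (use \<open>d > 0\<close> in auto)
qed

lemma continuous_on_slice:
  assumes "continuous_on closed_half_plane f"
  shows "continuous_on {0..} (\<lambda>t. f (t, x))"
  by (rule continuous_on_compose2[OF assms])
    (auto intro!: continuous_intros simp: closed_half_plane_def)

text \<open>If the bound failed at time \<open>t\<close>, then subtracting a small multiple of \<open>exp (M * (r - t))\<close> from
\<open>u - \<phi>\<close> would give an interior maximum, at which the strictly positive time derivative of the exponential
contradicts the subsolution inequality. A maximum on the top edge would not be an interior one; therefore
the box is first prolonged a little beyond time \<open>t\<close>, and \<open>M\<close> is taken so large that the exponential
dominates at the new top edge, while it is still harmless at time \<open>t\<close>.\<close>

lemma box_maximum_principle:
  assumes u: "visc_sub H u" and uc: "continuous_on closed_half_plane u"
    and \<phi>: "C1_half_plane \<phi> \<phi>t \<phi>x" and \<phi>c: "continuous_on closed_half_plane \<phi>"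
    and super: "\<And>z. z \<in> half_plane \<Longrightarrow> \<phi>t z + H (\<phi>x z) \<ge> 0"
    and st: "0 \<le> s" "s \<le> t"
    and bottom: "\<And>y. y \<in> {c..d} \<Longrightarrow> u (s, y) - \<phi> (s, y) < m"
    and sides: "\<And>r. r \<in> {s..t} \<Longrightarrow> u (r, c) - \<phi> (r, c) < m \<and> u (r, d) - \<phi> (r, d) < m"
    and x: "x \<in> {c..d}"
  shows "u (t, x) - \<phi> (t, x) < m"
proof (rule ccontr)
  define f where "f z = u z - \<phi> z" for z
  assume "\<not> u (t, x) - \<phi> (t, x) < m"
  then have ftx: "f (t, x) \<ge> m" by (simp add: f_def)
  have fc: "continuous_on closed_half_plane f"
    unfolding f_def by (intro continuous_intros uc \<phi>c)
  have sl: "f (r, c) < m" "f (r, d) < m" if "r \<in> {s..t}" for r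
    using sides[OF that] by (auto simp: f_def)
  obtain \<tau>1 where \<tau>1: "\<tau>1 > 0" "\<And>r. 0 \<le> r \<Longrightarrow> \<bar>r - t\<bar> \<le> \<tau>1 \<Longrightarrow> f (r, c) < m"
    by (rule continuous_less_nbhd[OF continuous_on_slice[OF fc, of c], of t m]) (use sl(1)[of t] st in auto)
  obtain \<tau>2 where \<tau>2: "\<tau>2 > 0" "\<And>r. 0 \<le> r \<Longrightarrow> \<bar>r - t\<bar> \<le> \<tau>2 \<Longrightarrow> f (r, d) < m"
    by (rule continuous_less_nbhd[OF continuous_on_slice[OF fc, of d], of t m]) (use sl(2)[of t] st in auto)
  define \<tau> where "\<tau> = min \<tau>1 \<tau>2"
  have \<tau>: "\<tau> > 0" "\<tau> \<le> \<tau>1" "\<tau> \<le> \<tau>2" using \<tau>1(1) \<tau>2(1) by (auto simp: \<tau>_def)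
  have side': "f (r, c) < m" "f (r, d) < m" if "s \<le> r" "r \<le> t + \<tau>" for r
    using sl[of r] \<tau>1(2)[of r] \<tau>2(2)[of r] that st \<tau> by (cases "r \<le> t"; auto)+
  define Q where "Q = {s..t + \<tau>} \<times> {c..d}"
  define P where "P = {s} \<times> {c..d} \<union> {s..t + \<tau>} \<times> {c, d}"
  have Qh: "Q \<subseteq> closed_half_plane" "P \<subseteq> closed_half_plane"
    using st by (auto simp: Q_def P_def closed_half_plane_def)
  have "compact P" "compact Q" unfolding P_def Q_def
    by (auto intro!: compact_Un compact_Times)
  moreover have "P \<noteq> {}" using x by (auto simp: P_def)
  ultimately obtain zP where zP: "zP \<in> P" "\<And>z. z \<in> P \<Longrightarrow> f z \<le> f zP"
    using continuous_attains_sup[of P f] continuous_on_subset[OF fc Qh(2)] by blast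
  have "f zP < m" using zP(1) bottom side' by (auto simp: P_def f_def)
  have txQ: "(t, x) \<in> Q" using x st \<tau>(1) by (auto simp: Q_def)
  obtain zQ where zQ: "zQ \<in> Q" "\<And>z. z \<in> Q \<Longrightarrow> f z \<le> f zQ"
    using continuous_attains_sup[of Q f] continuous_on_subset[OF fc Qh(1)] txQ \<open>compact Q\<close> by blast
  define \<eta> where "\<eta> = (m - f zP) / 2"
  have \<eta>: "\<eta> > 0" using \<open>f zP < m\<close> by (simp add: \<eta>_def)
  define A where "A = \<bar>f zQ\<bar> + \<bar>m\<bar> + 1"
  \<comment> \<open>chosen so that \<open>\<eta> * (1 + M * \<tau>)\<close>, a lower bound for the exponential at the top edge, exceeds the range of \<open>f\<close>\<close>
  define M where "M = A / (\<eta> * \<tau>)"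
  have M: "M > 0" using \<eta> \<tau> by (auto simp: M_def A_def intro!: divide_pos_pos mult_pos_pos)
  define E where "E z = \<eta> * exp (M * (fst z - t))" for z :: "real \<times> real"
  have "continuous_on Q (\<lambda>z. f z - E z)"
    unfolding E_def by (intro continuous_intros continuous_on_subset[OF fc Qh(1)])
  then obtain z0 where z0: "z0 \<in> Q" "\<And>z. z \<in> Q \<Longrightarrow> f z - E z \<le> f z0 - E z0"
    using continuous_attains_sup[of Q "\<lambda>z. f z - E z"] txQ \<open>compact Q\<close> by blast
  have big: "f z0 - E z0 \<ge> m - \<eta>"
    using z0(2)[OF txQ] ftx by (simp add: E_def)
  have "E z > 0" for z using \<eta> by (simp add: E_def)
  have notP: "z0 \<notin> P"
  proof
    assume "z0 \<in> P"
    then show False using zP(2)[of z0] big \<open>E z0 > 0\<close> \<open>f zP < m\<close> unfolding \<eta>_def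
      by (simp add: field_simps)
  qed
  have nottop: "fst z0 \<noteq> t + \<tau>"
  proof
    assume *: "fst z0 = t + \<tau>"
    have "E z0 = \<eta> * exp (M * \<tau>)" by (simp add: E_def *)
    also have "\<dots> \<ge> \<eta> * (1 + M * \<tau>)"
      using \<eta> by (intro mult_left_mono exp_ge_add_one_self) auto
    also have "\<eta> * (1 + M * \<tau>) = \<eta> + A"
      using \<eta> \<tau> by (simp add: M_def distrib_left)
    finally have "E z0 \<ge> \<eta> + (\<bar>f zQ\<bar> + \<bar>m\<bar> + 1)" by (simp add: A_def)
    then show False using big zQ(2)[OF z0(1)] by linarith
  qed
  have inside: "z0 \<in> {s<..<t + \<tau>} \<times> {c<..<d}"
    using z0(1) notP nottop by (cases z0) (auto simp: Q_def P_def)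
  have "\<forall>\<^sub>F w in nhds z0. w \<in> {s<..<t + \<tau>} \<times> {c<..<d}"
    by (intro eventually_nhds_in_open inside open_Times) auto
  then have "\<forall>\<^sub>F w in nhds z0. u w - (\<phi> w + E w) \<le> u z0 - (\<phi> z0 + E z0)"
  proof (rule eventually_mono)
    fix w assume "w \<in> {s<..<t + \<tau>} \<times> {c<..<d}"
    then have "w \<in> Q" by (auto simp: Q_def)
    then show "u w - (\<phi> w + E w) \<le> u z0 - (\<phi> z0 + E z0)"
      using z0(2)[of w] by (simp add: f_def)
  qed
  moreover have hz: "z0 \<in> half_plane" using inside st by (auto simp: half_plane_def)
  moreover note C1_half_plane_add[OF \<phi> C1_half_plane_exp[of \<eta> M t, folded E_def]]
  ultimately have "(\<phi>t z0 + \<eta> * M * exp (M * (fst z0 - t))) + H (\<phi>x z0 + 0) \<le> 0"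
    using visc_subD[OF u] by blast
  moreover have "\<eta> * M * exp (M * (fst z0 - t)) > 0" using \<eta> M by simp
  ultimately show False using super[OF hz] by simp
qed

section \<open>Comparison of viscosity solutions\<close>

lemma C1_doubling_penalty:
  fixes a :: "real \<times> real"
  assumes "\<epsilon> \<noteq> 0"
  shows "C1_half_plane
    (\<lambda>z. ((fst z - fst a)\<^sup>2 + (snd z - snd a)\<^sup>2) / \<epsilon> + \<delta> * (snd z)\<^sup>2 + \<eta> * exp (M * (fst z - r)))
    (\<lambda>z. 2 * (fst z - fst a) / \<epsilon> + \<eta> * M * exp (M * (fst z - r)))
    (\<lambda>z. 2 * (snd z - snd a) / \<epsilon> + 2 * \<delta> * snd z)"
  using assms
  by (intro C1_half_planeI)
    (auto intro!: continuous_intros derivative_eq_intros simp: fun_eq_iff field_simps)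

lemma dist_prod_less:
  fixes a b :: "real \<times> real"
  assumes "(fst a - fst b)\<^sup>2 + (snd a - snd b)\<^sup>2 < d\<^sup>2" "d > 0"
  shows "dist a b < d"
  using assms by (auto simp: dist_prod_def dist_real_def intro!: real_less_lsqrt)

lemma BUC_loc_modulus:
  assumes "u \<in> BUC_loc" "T > 0" "\<eta> > 0"
  obtains d where "d > 0" "\<And>a b. a \<in> {0..<T} \<times> UNIV \<Longrightarrow> b \<in> {0..<T} \<times> UNIV \<Longrightarrow> dist a b < d \<Longrightarrow>
    \<bar>u a - u b\<bar> < \<eta>"
proof -
  have "uniformly_continuous_on ({0..<T} \<times> UNIV) u" using assms by (simp add: BUC_loc_def)
  then obtain d where "d > 0" and
    "\<forall>a\<in>{0..<T} \<times> UNIV. \<forall>b\<in>{0..<T} \<times> UNIV. dist b a < d \<longrightarrow> dist (u b) (u a) < \<eta>"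
    unfolding uniformly_continuous_on_def using \<open>\<eta> > 0\<close> by meson
  then show thesis using that[of d] by (metis dist_real_def)
qed

lemma BUC_loc_bound:
  assumes "u \<in> BUC_loc" "T > 0"
  obtains B where "\<And>a. a \<in> {0..<T} \<times> UNIV \<Longrightarrow> \<bar>u a\<bar> \<le> B"
  using assms unfolding BUC_loc_def bounded_iff by (force simp del: mem_Sigma_iff)

text \<open>The doubling of variables: the maximum of
\<open>u a - v b - \<bar>a - b\<bar>\<^sup>2 / \<epsilon> - \<delta> * (x\<^sup>2 + y\<^sup>2) - g t - g s\<close>, where \<open>a = (t, x)\<close> and \<open>b = (s, y)\<close>, yields test
functions for \<open>u\<close> at \<open>a\<close> and for \<open>v\<close> at \<open>b\<close>, and the difference of the two viscosity inequalities bounds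
\<open>g' t + g' s\<close> by an increment of \<open>H\<close>. For fixed \<open>\<epsilon>\<close> the slopes involved stay in a fixed compact interval, and
a small \<open>\<delta>\<close> makes the two arguments of \<open>H\<close> close; so uniform continuity of \<open>H\<close> on that interval applies. As in
\<open>box_maximum_principle\<close>, the increasing exponential \<open>g\<close> both supplies the strict inequality and keeps the
maximum away from the final time.\<close>

theorem comparison_principle:
  assumes H: "continuous_on UNIV H"
    and u: "visc_sub H u" "u \<in> BUC_loc" and v: "visc_super H v" "v \<in> BUC_loc"
    and t12: "0 \<le> t1" "t1 \<le> t2"
    and init: "\<And>x. u (t1, x) - v (t1, x) \<le> m"
  shows "u (t2, x2) - v (t2, x2) \<le> m"
proof (rule ccontr)
  define \<eta> where "\<eta> = (u (t2, x2) - v (t2, x2) - m) / 5"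
  assume "\<not> u (t2, x2) - v (t2, x2) \<le> m"
  then have \<eta>: "\<eta> > 0" by (simp add: \<eta>_def)
  have gap: "u (t2, x2) - v (t2, x2) = m + 5 * \<eta>" by (simp add: \<eta>_def diff_divide_distrib)
  define L where "L = {0..<t2 + 2} \<times> (UNIV :: real set)"
  have T: "t2 + 2 > 0" using t12 by simp
  obtain Bu where Bu: "\<And>a. a \<in> L \<Longrightarrow> \<bar>u a\<bar> \<le> Bu"
    unfolding L_def by (rule BUC_loc_bound[OF u(2) T]) blast
  obtain Bv where Bv: "\<And>a. a \<in> L \<Longrightarrow> \<bar>v a\<bar> \<le> Bv"
    unfolding L_def by (rule BUC_loc_bound[OF v(2) T]) blast
  obtain du where du: "du > 0" "\<And>a b. a \<in> L \<Longrightarrow> b \<in> L \<Longrightarrow> dist a b < du \<Longrightarrow> \<bar>u a - u b\<bar> < \<eta>"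
    unfolding L_def by (rule BUC_loc_modulus[OF u(2) T \<eta>]) blast
  obtain dv where dv: "dv > 0" "\<And>a b. a \<in> L \<Longrightarrow> b \<in> L \<Longrightarrow> dist a b < dv \<Longrightarrow> \<bar>v a - v b\<bar> < \<eta>"
    unfolding L_def by (rule BUC_loc_modulus[OF v(2) T \<eta>]) blast
  define C where "C = Bu + Bv + \<bar>m\<bar> + 1"
  have "(0, 0) \<in> L" using T by (auto simp: L_def)
  then have "Bu \<ge> 0" "Bv \<ge> 0" using Bu[of "(0,0)"] Bv[of "(0,0)"] by linarith+
  then have C: "C > 0" by (simp add: C_def)
  have uvC: "u a - v b - m < C" if "a \<in> L" "b \<in> L" for a b
    using Bu[OF that(1)] Bv[OF that(2)] by (simp add: C_def)
  define M where "M = C / \<eta>"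
  have M: "M > 0" using C \<eta> by (simp add: M_def)
  define g where "g t = \<eta> * exp (M * (t - t2))" for t
  have gpos: "g t > 0" for t using \<eta> by (simp add: g_def)
  have gtop: "g (t2 + 1) > C"
  proof -
    have "g (t2 + 1) \<ge> \<eta> * (1 + M)"
      unfolding g_def using \<eta> by (auto intro!: mult_left_mono)
    moreover have "\<eta> * (1 + M) = \<eta> + C" using \<eta> by (simp add: M_def distrib_left)
    ultimately show ?thesis using \<eta> by linarith
  qed
  define \<gamma> where "\<gamma> = M * g t1"
  have \<gamma>: "\<gamma> > 0" using M gpos by (simp add: \<gamma>_def)
  have g': "\<eta> * M * exp (M * (t - t2)) \<ge> \<gamma>" if "t \<ge> t1" for t
    using M \<eta> that by (auto simp: \<gamma>_def g_def algebra_simps)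
  define d0 where "d0 = min du dv"
  have d0: "d0 > 0" using du(1) dv(1) by (simp add: d0_def)
  \<comment> \<open>the penalty is at most \<open>C\<close> at the maximum, which then forces the two points closer than \<open>d0\<close>\<close>
  define \<epsilon> where "\<epsilon> = d0\<^sup>2 / C"
  have \<epsilon>: "\<epsilon> > 0" using d0 C by (simp add: \<epsilon>_def)
  define P where "P = 2 * d0 / \<epsilon>"
  have "P \<ge> 0" using d0 \<epsilon> by (simp add: P_def)
  have "uniformly_continuous_on {- P - 1..P + 1} H"
    by (intro compact_uniformly_continuous continuous_on_subset[OF H]) auto
  then obtain \<rho> where \<rho>: "\<rho> > 0" and
    Hmod: "\<And>p q. p \<in> {- P - 1..P + 1} \<Longrightarrow> q \<in> {- P - 1..P + 1} \<Longrightarrow> \<bar>p - q\<bar> < \<rho> \<Longrightarrow> \<bar>H p - H q\<bar> < \<gamma>"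
    unfolding uniformly_continuous_on_def dist_real_def using \<gamma> by blast
  \<comment> \<open>small enough for the terms \<open>2 * \<delta> * x\<close> in the slopes to stay below the modulus \<open>\<rho>\<close>\<close>
  define \<delta>0 where "\<delta>0 = (min 1 \<rho> / 4)\<^sup>2 / C"
  define \<delta> where "\<delta> = min \<delta>0 (\<eta> / (2 * (x2\<^sup>2 + 1)))"
  have \<delta>0: "\<delta>0 > 0" using \<rho> C by (simp add: \<delta>0_def)
  have \<delta>: "\<delta> > 0" using \<delta>0 \<eta> by (auto simp: \<delta>_def intro!: divide_pos_pos add_nonneg_pos)
  have \<delta>C: "\<delta> * C \<le> (min 1 \<rho> / 4)\<^sup>2"
  proof -
    have "\<delta> * C \<le> \<delta>0 * C" using C by (intro mult_right_mono) (auto simp: \<delta>_def)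
    then show ?thesis using C by (simp add: \<delta>0_def)
  qed
  have \<delta>x2: "2 * \<delta> * x2\<^sup>2 \<le> \<eta>"
  proof -
    have "2 * \<delta> * x2\<^sup>2 \<le> 2 * \<delta> * (x2\<^sup>2 + 1)" using \<delta> by simp
    also have "\<dots> \<le> 2 * (\<eta> / (2 * (x2\<^sup>2 + 1))) * (x2\<^sup>2 + 1)"
      by (intro mult_right_mono mult_left_mono) (auto simp: \<delta>_def)
    also have "\<dots> = \<eta>" by (simp add: field_simps add_nonneg_eq_0_iff)
    finally show ?thesis .
  qed
  define R where "R = C / \<delta> + \<bar>x2\<bar> + 1"
  have R: "R > 1" "R > \<bar>x2\<bar>" "\<delta> * R\<^sup>2 \<ge> C"
  proof -
    show "R > 1" "R > \<bar>x2\<bar>" using C \<delta> by (auto simp: R_def add_pos_nonneg)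
    have "C / \<delta> \<le> R" by (simp add: R_def)
    also have "R \<le> R\<^sup>2" using \<open>R > 1\<close> by (simp add: power2_eq_square)
    finally show "\<delta> * R\<^sup>2 \<ge> C" using \<delta> by (simp add: field_simps)
  qed
  define Q where "Q = {t1..t2 + 1} \<times> {- R..R}"
  have QL: "Q \<subseteq> L" "Q \<subseteq> closed_half_plane"
    using t12 by (auto simp: Q_def L_def closed_half_plane_def)
  define \<Phi> where "\<Phi> a b = u a - v b - ((fst a - fst b)\<^sup>2 + (snd a - snd b)\<^sup>2) / \<epsilon>
     - \<delta> * (snd a)\<^sup>2 - \<delta> * (snd b)\<^sup>2 - g (fst a) - g (fst b)" for a b
  have "continuous_on (Q \<times> Q) (\<lambda>q. \<Phi> (fst q) (snd q))"
    unfolding \<Phi>_def g_def using u(2) v(2) QL \<epsilon>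
    by (auto intro!: continuous_intros continuous_on_compose2[where s = "Q \<times> Q" and f = fst]
        continuous_on_compose2[where s = "Q \<times> Q" and f = snd]
        intro: continuous_on_subset simp: BUC_loc_def)
  moreover have "compact (Q \<times> Q)" unfolding Q_def by (intro compact_Times) auto
  moreover have z2: "(t2, x2) \<in> Q" using t12 R by (auto simp: Q_def)
  ultimately obtain q where q: "q \<in> Q \<times> Q"
      "\<And>q'. q' \<in> Q \<times> Q \<Longrightarrow> \<Phi> (fst q') (snd q') \<le> \<Phi> (fst q) (snd q)"
    using continuous_attains_sup[of "Q \<times> Q" "\<lambda>q. \<Phi> (fst q) (snd q)"] by blast
  define a b where "a = fst q" and "b = snd q"
  have ab: "a \<in> Q" "b \<in> Q" and max: "\<And>a' b'. a' \<in> Q \<Longrightarrow> b' \<in> Q \<Longrightarrow> \<Phi> a' b' \<le> \<Phi> a b"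
    using q by (force simp: a_def b_def)+
  have "\<Phi> (t2, x2) (t2, x2) \<ge> m + 2 * \<eta>"
    using gap \<delta>x2 by (simp add: \<Phi>_def g_def)
  then have big: "\<Phi> a b \<ge> m + 2 * \<eta>" using max[OF z2 z2] by simp
  have Q_bnd: "((fst a - fst b)\<^sup>2 + (snd a - snd b)\<^sup>2) / \<epsilon> + \<delta> * (snd a)\<^sup>2 + \<delta> * (snd b)\<^sup>2
     + g (fst a) + g (fst b) < C"
    using big uvC[of a b] ab QL(1) \<eta> by (force simp: \<Phi>_def)
  note nonneg = gpos[of "fst a"] gpos[of "fst b"]
    mult_nonneg_nonneg[OF less_imp_le[OF \<delta>] zero_le_power2[of "snd a"]]
    mult_nonneg_nonneg[OF less_imp_le[OF \<delta>] zero_le_power2[of "snd b"]]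
    divide_nonneg_pos[OF add_nonneg_nonneg[OF zero_le_power2[of "fst a - fst b"]
       zero_le_power2[of "snd a - snd b"]] \<epsilon>]
  have "((fst a - fst b)\<^sup>2 + (snd a - snd b)\<^sup>2) / \<epsilon> < C"
    using Q_bnd nonneg by linarith
  moreover have "C * \<epsilon> = d0\<^sup>2" using C by (simp add: \<epsilon>_def)
  ultimately have close: "(fst a - fst b)\<^sup>2 + (snd a - snd b)\<^sup>2 < d0\<^sup>2"
    by (simp only: pos_divide_less_eq[OF \<epsilon>])
  then have dab: "dist a b < du" "dist a b < dv"
    using dist_prod_less[OF close d0] by (auto simp: d0_def)
  \<comment> \<open>from \<open>\<delta> * y\<^sup>2 < C\<close>: the square of \<open>\<delta> * y\<close> is at most \<open>\<delta> * C\<close>\<close>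
  have small: "\<bar>2 * \<delta> * y\<bar> < \<rho> / 2 \<and> \<bar>2 * \<delta> * y\<bar> < 1 \<and> \<bar>y\<bar> < R" if "\<delta> * y\<^sup>2 < C" for y
  proof -
    have "(\<delta> * y)\<^sup>2 = \<delta> * (\<delta> * y\<^sup>2)" by (simp add: power2_eq_square)
    also have "\<dots> < \<delta> * C" using \<delta> that by simp
    also note \<delta>C
    finally have "\<bar>\<delta> * y\<bar>\<^sup>2 < (min 1 \<rho> / 4)\<^sup>2" by (simp only: power2_abs)
    then have "\<bar>\<delta> * y\<bar> < min 1 \<rho> / 4"
      by (rule power2_less_imp_less) (use \<rho> in simp)
    moreover have "\<delta> * y\<^sup>2 < \<delta> * R\<^sup>2" using that R(3) by linarith
    then have "\<bar>y\<bar>\<^sup>2 < R\<^sup>2" using \<delta> by simp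
    then have "\<bar>y\<bar> < R" by (rule power2_less_imp_less) (use R(1) in simp)
    ultimately show ?thesis by (simp add: mult.assoc abs_mult[of 2])
  qed
  have sa: "\<delta> * (snd a)\<^sup>2 < C" and sb: "\<delta> * (snd b)\<^sup>2 < C"
    using Q_bnd nonneg by linarith+
  have top: "fst a \<noteq> t2 + 1" "fst b \<noteq> t2 + 1"
    using Q_bnd nonneg gtop by (smt (verit))+
  have uv: "u a - v b > m + \<eta>" using big nonneg \<eta> by (simp add: \<Phi>_def)
  have bota: "fst a \<noteq> t1"
  proof
    assume "fst a = t1"
    then have "a = (t1, snd a)" by (metis prod.collapse)
    then show False using init[of "snd a"] dv(2)[of a b] dab ab QL(1) uv by (smt (verit) subsetD)
  qed
  have botb: "fst b \<noteq> t1"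
  proof
    assume "fst b = t1"
    then have "b = (t1, snd b)" by (metis prod.collapse)
    then show False using init[of "snd b"] du(2)[of a b] dab ab QL(1) uv by (smt (verit) subsetD)
  qed
  define W where "W = {t1<..<t2 + 1} \<times> {- R<..<R}"
  have W: "open W" "W \<subseteq> Q" "a \<in> W" "b \<in> W"
    using ab top bota botb small[OF sa] small[OF sb]
    by (auto simp: W_def Q_def mem_Times_iff abs_less_iff intro!: open_Times)
  have abh: "a \<in> half_plane" "b \<in> half_plane" using W t12 by (auto simp: W_def half_plane_def)
  define \<psi> where "\<psi> c z = ((fst z - fst c)\<^sup>2 + (snd z - snd c)\<^sup>2) / \<epsilon> + \<delta> * (snd z)\<^sup>2
     + \<eta> * exp (M * (fst z - t2))" for c z :: "real \<times> real"
  have C1: "C1_half_plane (\<psi> c) (\<lambda>z. 2 * (fst z - fst c) / \<epsilon> + \<eta> * M * exp (M * (fst z - t2)))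
    (\<lambda>z. 2 * (snd z - snd c) / \<epsilon> + 2 * \<delta> * snd z)" for c
    unfolding \<psi>_def using C1_doubling_penalty[of \<epsilon> c \<delta> \<eta> M t2] \<epsilon> by simp
  have \<Phi>1: "\<Phi> z b = u z - \<psi> b z - (v b + \<delta> * (snd b)\<^sup>2 + g (fst b))" for z
    by (simp add: \<Phi>_def \<psi>_def g_def)
  have \<Phi>2: "\<Phi> a z = - (v z - - \<psi> a z) + (u a - \<delta> * (snd a)\<^sup>2 - g (fst a))" for z
    by (simp add: \<Phi>_def \<psi>_def g_def power2_commute[of "fst a"] power2_commute[of "snd a"])
  have "\<forall>\<^sub>F w in nhds a. u w - \<psi> b w \<le> u a - \<psi> b a"
    using eventually_nhds_in_open[OF W(1,3)]
    by (rule eventually_mono) (use max[OF _ ab(2)] W(2) in \<open>force simp: \<Phi>1\<close>)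
  from visc_subD[OF u(1) C1 abh(1) this]
  have A: "2 * (fst a - fst b) / \<epsilon> + \<eta> * M * exp (M * (fst a - t2))
      + H (2 * (snd a - snd b) / \<epsilon> + 2 * \<delta> * snd a) \<le> 0" .
  have "\<forall>\<^sub>F w in nhds b. v b - - \<psi> a b \<le> v w - - \<psi> a w"
    using eventually_nhds_in_open[OF W(1,4)]
    by (rule eventually_mono) (use max[OF ab(1)] W(2) in \<open>force simp: \<Phi>2\<close>)
  then have B: "- (2 * (fst b - fst a) / \<epsilon> + \<eta> * M * exp (M * (fst b - t2)))
      + H (- (2 * (snd b - snd a) / \<epsilon> + 2 * \<delta> * snd b)) \<ge> 0"
    using visc_superD[OF v(1) C1_half_plane_uminus[OF C1[of a]] abh(2)] by blast
  define p where "p = 2 * (snd a - snd b) / \<epsilon>"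
  have "(snd a - snd b)\<^sup>2 < d0\<^sup>2" using close by (smt (verit) zero_le_power2)
  then have "\<bar>snd a - snd b\<bar> < d0" using d0 by (metis abs_of_pos real_sqrt_abs real_sqrt_less_iff)
  then have "\<bar>p\<bar> \<le> P" unfolding p_def P_def using \<epsilon> by (simp add: abs_mult divide_right_mono)
  then have "\<bar>H (p - 2 * \<delta> * snd b) - H (p + 2 * \<delta> * snd a)\<bar> < \<gamma>"
    using small[OF sa] small[OF sb] by (intro Hmod) auto
  moreover have "- (2 * (snd b - snd a) / \<epsilon> + 2 * \<delta> * snd b) = p - 2 * \<delta> * snd b"
    by (simp add: p_def diff_divide_distrib right_diff_distrib)
  moreover have "2 * (fst b - fst a) / \<epsilon> = - (2 * (fst a - fst b) / \<epsilon>)" by (simp add: diff_divide_distrib right_diff_distrib)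
  ultimately show False
    using A B g'[of "fst a"] g'[of "fst b"] W \<gamma> unfolding p_def[symmetric] W_def by auto
qed

section \<open>Ordered patterns can be traced back in time\<close>

text \<open>Up to time \<open>T\<close>, a set \<open>{f \<ge> m}\<close> cannot come up inside an interval: it can only enter through the
endpoints. This is the form in which the maximum principle is used for the comparison of \<open>u\<close> with smooth
functions.\<close>

definition no_creation :: "real \<Rightarrow> real \<Rightarrow> (real \<times> real \<Rightarrow> real) \<Rightarrow> bool" where
  "no_creation T m f \<longleftrightarrow> (\<forall>s t c d. 0 \<le> s \<longrightarrow> s \<le> t \<longrightarrow> t \<le> T \<longrightarrow>
     (\<forall>y\<in>{c..d}. f (s, y) < m) \<longrightarrow> (\<forall>r\<in>{s..t}. f (r, c) < m \<and> f (r, d) < m) \<longrightarrow>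
     (\<forall>x\<in>{c..d}. f (t, x) < m))"

lemma no_creation_trace_back:
  assumes f: "no_creation T m f" and st: "0 \<le> s" "s \<le> t" "t \<le> T"
    and sides: "\<And>r. r \<in> {s..t} \<Longrightarrow> f (r, c) < m \<and> f (r, d) < m"
    and x: "x \<in> {c..d}" "f (t, x) \<ge> m"
  obtains y where "y \<in> {c..d}" "f (s, y) \<ge> m"
proof (rule ccontr)
  assume "\<not> thesis"
  then have "\<forall>y\<in>{c..d}. f (s, y) < m" using that by force
  then have "f (t, x) < m" using f st sides x unfolding no_creation_def by blast
  then show False using x by simp
qed

text \<open>The sets \<open>{f \<ge> m}\<close> and \<open>{g \<ge> m}\<close> are closed and disjoint, so they cannot cover the interval.\<close>

lemma separating_point:
  fixes f g :: "real \<Rightarrow> real"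
  assumes "continuous_on UNIV f" "continuous_on UNIV g"
    and "y \<le> z" "f y \<ge> m" "g z \<ge> m" and disj: "\<And>x. f x < m \<or> g x < m"
  obtains x where "x \<in> {y..z}" "f x < m" "g x < m"
proof (rule ccontr)
  assume *: "\<not> thesis"
  let ?A = "{x. m \<le> f x}" and ?B = "{x. m \<le> g x}"
  have "closed ?A" "closed ?B"
    using assms(1,2) by (auto intro!: closed_Collect_le continuous_intros)
  moreover have "{y..z} \<subseteq> ?A \<union> ?B" using * that by force
  moreover have "?A \<inter> ?B \<inter> {y..z} = {}" using disj by (auto simp: not_le[symmetric])
  moreover have "?A \<inter> {y..z} \<noteq> {}" "?B \<inter> {y..z} \<noteq> {}" using assms by auto
  ultimately show False using connected_Icc[of y z] unfolding connected_closed by blast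
qed

lemma continuous_on_section:
  assumes "continuous_on closed_half_plane f" "0 \<le> t"
  shows "continuous_on S (\<lambda>x. f (t, x))"
  by (rule continuous_on_compose2[OF assms(1)])
    (use assms(2) in \<open>auto intro!: continuous_intros simp: closed_half_plane_def\<close>)

text \<open>Consider the first time at which the ordered pattern is present; it exists by compactness. If it were
positive, points between the members of the pattern at which all the functions involved are below \<open>m\<close>
would stay such points for slightly earlier times. They split the line into three intervals, and by
\<open>no_creation\<close> each member has a predecessor in its own interval. So the order is kept and the pattern is
already present earlier.\<close>

lemma ordered_triple_trace_back:
  assumes cont: "continuous_on closed_half_plane f1" "continuous_on closed_half_plane f2"
      "continuous_on closed_half_plane f3"
    and nc: "no_creation T m f1" "no_creation T m f2" "no_creation T m f3"
    and disj: "\<And>t x. t \<in> {0..T} \<Longrightarrow> f1 (t, x) < m \<or> f2 (t, x) < m"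
      "\<And>t x. t \<in> {0..T} \<Longrightarrow> f2 (t, x) < m \<or> f3 (t, x) < m"
    and far: "\<And>t x. t \<in> {0..T} \<Longrightarrow> x \<le> - R \<Longrightarrow> f1 (t, x) < m"
      "\<And>t x. t \<in> {0..T} \<Longrightarrow> x \<ge> R \<Longrightarrow> f3 (t, x) < m"
    and T: "T \<ge> 0"
    and start: "x1 \<le> x2" "x2 \<le> x3" "f1 (T, x1) \<ge> m" "f2 (T, x2) \<ge> m" "f3 (T, x3) \<ge> m"
  obtains z1 z2 z3 where "z1 \<le> z2" "z2 \<le> z3" "f1 (0, z1) \<ge> m" "f2 (0, z2) \<ge> m" "f3 (0, z3) \<ge> m"
proof -
  define D where "D = {0..T} \<times> {- R..R}"
  have Dh: "D \<subseteq> closed_half_plane" by (auto simp: D_def closed_half_plane_def)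
  have "compact D" unfolding D_def by (intro compact_Times) auto
  define K where "K = {(a, b, c). a \<in> D \<and> b \<in> D \<and> c \<in> D \<and> fst b = fst a \<and> fst c = fst a \<and>
    snd a \<le> snd b \<and> snd b \<le> snd c \<and> m \<le> f1 a \<and> m \<le> f2 b \<and> m \<le> f3 c}"
  have in_K: "((t, y1), (t, y2), (t, y3)) \<in> K"
    if "t \<in> {0..T}" "y1 \<le> y2" "y2 \<le> y3" "f1 (t, y1) \<ge> m" "f2 (t, y2) \<ge> m" "f3 (t, y3) \<ge> m" for t y1 y2 y3
  proof -
    have "\<not> y1 \<le> - R" "\<not> y3 \<ge> R" using far[OF that(1)] that by force+
    then show ?thesis using that by (auto simp: K_def D_def)
  qed
  have "compact K"
  proof -
    let ?X = "D \<times> D \<times> D"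
    have c1: "continuous_on ?X (\<lambda>q. f1 (fst q))"
      by (rule continuous_on_compose2[OF cont(1)]) (use Dh in \<open>auto intro!: continuous_intros\<close>)
    have c2: "continuous_on ?X (\<lambda>q. f2 (fst (snd q)))"
      by (rule continuous_on_compose2[OF cont(2)]) (use Dh in \<open>auto intro!: continuous_intros\<close>)
    have c3: "continuous_on ?X (\<lambda>q. f3 (snd (snd q)))"
      by (rule continuous_on_compose2[OF cont(3)]) (use Dh in \<open>auto intro!: continuous_intros\<close>)
    have X: "compact ?X" using \<open>compact D\<close> by (intro compact_Times)
    then have cl: "closed ?X" by (rule compact_imp_closed)
    have "K = ?X \<inter> {q. fst (fst (snd q)) = fst (fst q) \<and> fst (snd (snd q)) = fst (fst q) \<and>
        snd (fst q) \<le> snd (fst (snd q)) \<and> snd (fst (snd q)) \<le> snd (snd (snd q))}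
      \<inter> (?X \<inter> (\<lambda>q. f1 (fst q)) -` {m..}) \<inter> (?X \<inter> (\<lambda>q. f2 (fst (snd q))) -` {m..})
      \<inter> (?X \<inter> (\<lambda>q. f3 (snd (snd q))) -` {m..})"
      by (auto simp: K_def)
    moreover have "closed {q :: (real\<times>real)\<times>(real\<times>real)\<times>(real\<times>real). fst (fst (snd q)) = fst (fst q) \<and> fst (snd (snd q)) = fst (fst q) \<and>
        snd (fst q) \<le> snd (fst (snd q)) \<and> snd (fst (snd q)) \<le> snd (snd (snd q))}"
      by (intro closed_Collect_conj closed_Collect_eq closed_Collect_le continuous_intros)
    moreover note continuous_closed_preimage[OF c1 cl closed_atLeast]
      continuous_closed_preimage[OF c2 cl closed_atLeast]
      continuous_closed_preimage[OF c3 cl closed_atLeast]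
    ultimately show ?thesis using X by (metis (no_types, lifting) compact_Int_closed)
  qed
  moreover have "K \<noteq> {}" using in_K[OF _ start] T by force
  moreover have "continuous_on K (\<lambda>q. fst (fst q))" by (intro continuous_intros)
  ultimately obtain q where q: "q \<in> K" "\<And>q'. q' \<in> K \<Longrightarrow> fst (fst q) \<le> fst (fst q')"
    using continuous_attains_inf[of K "\<lambda>q. fst (fst q)"] by blast
  define t where "t = fst (fst q)"
  define y1 y2 y3 where "y1 = snd (fst q)" and "y2 = snd (fst (snd q))" and "y3 = snd (snd (snd q))"
  have t: "t \<in> {0..T}" and y: "y1 \<le> y2" "y2 \<le> y3" "f1 (t, y1) \<ge> m" "f2 (t, y2) \<ge> m" "f3 (t, y3) \<ge> m"
    using q(1) by (auto simp: K_def D_def t_def y1_def y2_def y3_def)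
  have first: "t \<le> t'" if "t' \<in> {0..T}" "y1' \<le> y2'" "y2' \<le> y3'" "f1 (t', y1') \<ge> m" "f2 (t', y2') \<ge> m"
      "f3 (t', y3') \<ge> m" for t' y1' y2' y3'
    using q(2)[OF in_K[OF that]] by (simp add: t_def)
  have "t = 0"
  proof (rule ccontr)
    assume "t \<noteq> 0"
    then have t0: "t > 0" "t \<le> T" using t by auto
    have sec: "continuous_on UNIV (\<lambda>x. f (t, x))" if "continuous_on closed_half_plane f" for f
      using continuous_on_section[OF that] t0 by simp
    obtain l where l: "l \<in> {y1..y2}" "f1 (t, l) < m" "f2 (t, l) < m"
      using separating_point[OF sec[OF cont(1)] sec[OF cont(2)] y(1,3,4) disj(1)[OF t]] by blast
    obtain r where r: "r \<in> {y2..y3}" "f2 (t, r) < m" "f3 (t, r) < m"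
      using separating_point[OF sec[OF cont(2)] sec[OF cont(3)] y(2,4,5) disj(2)[OF t]] by blast
    obtain \<tau>1 where \<tau>1: "\<tau>1 > 0" "\<And>s. 0 \<le> s \<Longrightarrow> \<bar>s - t\<bar> \<le> \<tau>1 \<Longrightarrow> f1 (s, l) < m"
      by (rule continuous_less_nbhd[OF continuous_on_slice[OF cont(1), of l], of t m]) (use l t0 in auto)
    obtain \<tau>2 where \<tau>2: "\<tau>2 > 0" "\<And>s. 0 \<le> s \<Longrightarrow> \<bar>s - t\<bar> \<le> \<tau>2 \<Longrightarrow> f2 (s, l) < m"
      by (rule continuous_less_nbhd[OF continuous_on_slice[OF cont(2), of l], of t m]) (use l t0 in auto)
    obtain \<tau>3 where \<tau>3: "\<tau>3 > 0" "\<And>s. 0 \<le> s \<Longrightarrow> \<bar>s - t\<bar> \<le> \<tau>3 \<Longrightarrow> f2 (s, r) < m"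
      by (rule continuous_less_nbhd[OF continuous_on_slice[OF cont(2), of r], of t m]) (use r t0 in auto)
    obtain \<tau>4 where \<tau>4: "\<tau>4 > 0" "\<And>s. 0 \<le> s \<Longrightarrow> \<bar>s - t\<bar> \<le> \<tau>4 \<Longrightarrow> f3 (s, r) < m"
      by (rule continuous_less_nbhd[OF continuous_on_slice[OF cont(3), of r], of t m]) (use r t0 in auto)
    define \<tau> where "\<tau> = Min {\<tau>1, \<tau>2, \<tau>3, \<tau>4, t}"
    have \<tau>: "0 < \<tau>" "\<tau> \<le> \<tau>1" "\<tau> \<le> \<tau>2" "\<tau> \<le> \<tau>3" "\<tau> \<le> \<tau>4" "\<tau> \<le> t"
      using \<tau>1(1) \<tau>2(1) \<tau>3(1) \<tau>4(1) t0 by (auto simp: \<tau>_def)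
    have s: "0 \<le> t - \<tau>" "t - \<tau> \<le> t" using \<tau> by auto
    have near: "f1 (s, l) < m" "f2 (s, l) < m" "f2 (s, r) < m" "f3 (s, r) < m" if "s \<in> {t - \<tau>..t}" for s
      using \<tau>1(2)[of s] \<tau>2(2)[of s] \<tau>3(2)[of s] \<tau>4(2)[of s] that \<tau> by auto
    obtain z1 where z1: "z1 \<in> {min (- R) y1..l}" "f1 (t - \<tau>, z1) \<ge> m"
      by (rule no_creation_trace_back[OF nc(1) s t0(2), of "min (- R) y1" l y1])
        (use near far(1) y l t0 \<tau> in auto)
    obtain z2 where z2: "z2 \<in> {l..r}" "f2 (t - \<tau>, z2) \<ge> m"
      by (rule no_creation_trace_back[OF nc(2) s t0(2), of l r y2]) (use near y l r in auto)
    obtain z3 where z3: "z3 \<in> {r..max R y3}" "f3 (t - \<tau>, z3) \<ge> m"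
      by (rule no_creation_trace_back[OF nc(3) s t0(2), of r "max R y3" y3])
        (use near far(2) y r t0 \<tau> in auto)
    have "t \<le> t - \<tau>"
      by (rule first[of "t - \<tau>" z1 z2 z3]) (use z1 z2 z3 s t0 in auto)
    then show False using \<tau> by simp
  qed
  then show thesis using that[of y1 y2 y3] y by simp
qed

lemma no_creation_const: "no_creation T m (\<lambda>z. f (snd z))"
  unfolding no_creation_def by auto

lemma no_creation_sub:
  assumes "visc_sub H u" "continuous_on closed_half_plane u"
    and "C1_half_plane \<phi> \<phi>t \<phi>x" "continuous_on closed_half_plane \<phi>"
    and "\<And>z. z \<in> half_plane \<Longrightarrow> \<phi>t z + H (\<phi>x z) \<ge> 0"
  shows "no_creation T m (\<lambda>z. u z - \<phi> z)"
  unfolding no_creation_def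
  by (intro allI impI ballI, rule box_maximum_principle[OF assms]) auto

lemma no_creation_super:
  assumes u: "visc_super H u" "continuous_on closed_half_plane u"
    and \<phi>: "C1_half_plane \<phi> \<phi>t \<phi>x" "continuous_on closed_half_plane \<phi>"
    and sub: "\<And>z. z \<in> half_plane \<Longrightarrow> \<phi>t z + H (\<phi>x z) \<le> 0"
  shows "no_creation T m (\<lambda>z. \<phi> z - u z)"
proof -
  have "0 \<le> - \<phi>t z + - H (- (- \<phi>x z))" if "z \<in> half_plane" for z
    using sub[OF that] by (simp only: minus_minus)
  moreover have "continuous_on closed_half_plane (\<lambda>z. - u z)" "continuous_on closed_half_plane (\<lambda>z. - \<phi> z)"
    by (auto intro!: continuous_intros u \<phi>)
  ultimately have "no_creation T m (\<lambda>z. - u z - - \<phi> z)"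
    using no_creation_sub[OF u(1)[folded visc_sub_uminus_iff] _ C1_half_plane_uminus[OF \<phi>(1)]]
    by blast
  then show ?thesis by (simp add: algebra_simps)
qed

section \<open>Persistent increments force the Hamiltonian to be linear\<close>

text \<open>Both the affine solutions and the hats have this form. The residual of the equation is
\<open>H q - (C * q + D)\<close> with \<open>q\<close> the slope of the profile. So an affine profile of slope \<open>k\<close> is an exact
solution if the line \<open>C * q + D\<close> meets the graph of \<open>H\<close> at \<open>k\<close>, and for two such slopes the intersection
point of the two affine solutions moves with speed \<open>C\<close> while its level changes with speed \<open>- D\<close>.\<close>

lemma C1_moving_profile:
  assumes \<psi>: "\<And>y. (\<psi> has_real_derivative \<psi>' y) (at y)" and \<psi>': "continuous_on UNIV \<psi>'"
  shows "C1_half_plane (\<lambda>z. E - D * fst z + \<psi> (snd z - C * fst z - X))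
    (\<lambda>z. - D - C * \<psi>' (snd z - C * fst z - X)) (\<lambda>z. \<psi>' (snd z - C * fst z - X))"
proof (rule C1_half_planeI)
  have "continuous_on UNIV (\<lambda>z :: real \<times> real. \<psi>' (snd z - C * fst z - X))"
    by (rule continuous_on_compose2[OF \<psi>']) (auto intro!: continuous_intros)
  then show "continuous_on UNIV (\<lambda>z :: real \<times> real. - D - C * \<psi>' (snd z - C * fst z - X))"
    "continuous_on UNIV (\<lambda>z :: real \<times> real. \<psi>' (snd z - C * fst z - X))"
    by (auto intro!: continuous_intros)
  fix z :: "real \<times> real"
  have "((\<lambda>z. \<psi> (snd z - C * fst z - X)) has_derivative
      (\<lambda>w. \<psi>' (snd z - C * fst z - X) * (snd w - C * fst w))) (at z)"
    by (rule has_derivative_compose[where g = \<psi>, OF _ \<psi>[THEN has_field_derivative_imp_has_derivative]])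
      (auto intro!: derivative_eq_intros)
  then have "((\<lambda>z. E - D * fst z + \<psi> (snd z - C * fst z - X)) has_derivative
      (\<lambda>w. 0 - D * fst w + \<psi>' (snd z - C * fst z - X) * (snd w - C * fst w))) (at z)"
    by (intro has_derivative_add has_derivative_diff has_derivative_const has_derivative_mult_right
        has_derivative_fst has_derivative_ident)
  then show "((\<lambda>z. E - D * fst z + \<psi> (snd z - C * fst z - X)) has_derivative
      (\<lambda>(h, k). (- D - C * \<psi>' (snd z - C * fst z - X)) * h + \<psi>' (snd z - C * fst z - X) * k)) (at z)"
    by (rule has_derivative_eq_rhs) (auto simp: fun_eq_iff algebra_simps)
qed

lemma continuous_on_moving_profile:
  assumes "\<And>y. (\<psi> has_real_derivative \<psi>' y) (at y)"
  shows "continuous_on S (\<lambda>z. E - D * fst z + \<psi> (snd z - C * fst z - X))"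
proof -
  have "continuous_on UNIV \<psi>"
    using assms by (meson DERIV_isCont continuous_at_imp_continuous_on)
  then have "continuous_on S (\<lambda>z. \<psi> (snd z - C * fst z - X))"
    by (rule continuous_on_compose2) (auto intro!: continuous_intros)
  then show ?thesis by (intro continuous_intros)
qed

text \<open>A smooth concave function with slopes strictly between \<open>k\<close> and \<open>k'\<close>, which lies below the minimum of
\<open>k * y\<close> and \<open>k' * y\<close> and approaches it as \<open>\<eta>\<close> tends to zero.\<close>

definition smooth_hat :: "real \<Rightarrow> real \<Rightarrow> real \<Rightarrow> real \<Rightarrow> real" where
  "smooth_hat k k' \<eta> y = (k + k') / 2 * y - (k' - k) / 2 * sqrt (y\<^sup>2 + \<eta>\<^sup>2)"

definition smooth_hat_deriv :: "real \<Rightarrow> real \<Rightarrow> real \<Rightarrow> real \<Rightarrow> real" where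
  "smooth_hat_deriv k k' \<eta> y = (k + k') / 2 - (k' - k) / 2 * (y / sqrt (y\<^sup>2 + \<eta>\<^sup>2))"

lemma smooth_hat_has_derivative:
  assumes "\<eta> > 0"
  shows "(smooth_hat k k' \<eta> has_real_derivative smooth_hat_deriv k k' \<eta> y) (at y)"
proof -
  have "y\<^sup>2 + \<eta>\<^sup>2 > 0" using assms by (simp add: add_nonneg_pos)
  then have "((\<lambda>y. sqrt (y\<^sup>2 + \<eta>\<^sup>2)) has_real_derivative y / sqrt (y\<^sup>2 + \<eta>\<^sup>2)) (at y)"
    by (auto intro!: derivative_eq_intros simp: field_simps)
  then show ?thesis unfolding smooth_hat_def smooth_hat_deriv_def
    by (intro DERIV_diff DERIV_cmult DERIV_cmult_Id)
qed

lemma smooth_hat_deriv_continuous: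
  assumes "\<eta> > 0"
  shows "continuous_on UNIV (smooth_hat_deriv k k' \<eta>)"
proof -
  have "y\<^sup>2 + \<eta>\<^sup>2 > 0" for y :: real using assms by (simp add: add_nonneg_pos)
  then have "sqrt (y\<^sup>2 + \<eta>\<^sup>2) \<noteq> 0" for y :: real by (metis less_irrefl real_sqrt_eq_zero_cancel_iff)
  then show ?thesis unfolding smooth_hat_deriv_def by (intro continuous_intros) auto
qed

lemma smooth_hat_deriv_between:
  assumes "k \<le> k'" "\<eta> > 0"
  shows "smooth_hat_deriv k k' \<eta> y \<in> {k..k'}"
proof -
  have pos: "sqrt (y\<^sup>2 + \<eta>\<^sup>2) > 0" using assms by (simp add: add_nonneg_pos)
  have "\<bar>y\<bar> \<le> sqrt (y\<^sup>2 + \<eta>\<^sup>2)" by (rule real_le_rsqrt) simp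
  then have "\<bar>y / sqrt (y\<^sup>2 + \<eta>\<^sup>2)\<bar> \<le> 1" using pos by (simp add: abs_divide)
  moreover define w where "w = (k' - k) / 2 * (y / sqrt (y\<^sup>2 + \<eta>\<^sup>2))"
  ultimately have "\<bar>w\<bar> \<le> (k' - k) / 2 * 1"
    unfolding w_def abs_mult using assms by (intro mult_mono) auto
  then have "k \<le> (k + k') / 2 - w" "(k + k') / 2 - w \<le> k'" by (simp_all add: abs_le_iff field_simps)
  then show ?thesis unfolding smooth_hat_deriv_def w_def by simp
qed

lemma smooth_hat_le:
  assumes "k \<le> k'"
  shows "smooth_hat k k' \<eta> y \<le> k * y" "smooth_hat k k' \<eta> y \<le> k' * y"
proof -
  have "\<bar>y\<bar> \<le> sqrt (y\<^sup>2 + \<eta>\<^sup>2)" by (rule real_le_rsqrt) simp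
  then have "(k' - k) / 2 * \<bar>y\<bar> \<le> (k' - k) / 2 * sqrt (y\<^sup>2 + \<eta>\<^sup>2)"
    using assms by (intro mult_left_mono) auto
  moreover have "(k' - k) / 2 * y \<le> (k' - k) / 2 * \<bar>y\<bar>" "(k' - k) / 2 * - y \<le> (k' - k) / 2 * \<bar>y\<bar>"
    using assms by (intro mult_left_mono; simp)+
  moreover have "smooth_hat k k' \<eta> y = k * y + (k' - k) / 2 * y - (k' - k) / 2 * sqrt (y\<^sup>2 + \<eta>\<^sup>2)"
    "smooth_hat k k' \<eta> y = k' * y + (k' - k) / 2 * - y - (k' - k) / 2 * sqrt (y\<^sup>2 + \<eta>\<^sup>2)"
    by (simp_all add: smooth_hat_def field_simps)
  ultimately show "smooth_hat k k' \<eta> y \<le> k * y" "smooth_hat k k' \<eta> y \<le> k' * y"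
    by linarith+
qed

lemma smooth_hat_0: "\<eta> > 0 \<Longrightarrow> smooth_hat k k' \<eta> 0 = - ((k' - k) / 2 * \<eta>)"
  by (simp add: smooth_hat_def)

locale bounded_solution =
  fixes H :: "real \<Rightarrow> real" and u :: "real \<times> real \<Rightarrow> real" and B :: real
  assumes sub: "visc_sub H u" and super: "visc_super H u"
    and cont: "continuous_on closed_half_plane u"
    and bound: "\<And>z. z \<in> closed_half_plane \<Longrightarrow> \<bar>u z\<bar> \<le> B"
begin

lemma bound': "0 \<le> t \<Longrightarrow> \<bar>u (t, x)\<bar> \<le> B"
  by (rule bound) (simp add: closed_half_plane_def)

lemma no_creation_line:
  assumes "H k = C * k + D"
  shows "no_creation T m (\<lambda>z. u z - (E - D * fst z + k * (snd z - C * fst z - X)))"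
    and "continuous_on closed_half_plane (\<lambda>z. u z - (E - D * fst z + k * (snd z - C * fst z - X)))"
proof -
  have d: "((*) k has_real_derivative k) (at y)" for y
    by (auto intro!: derivative_eq_intros)
  show "no_creation T m (\<lambda>z. u z - (E - D * fst z + k * (snd z - C * fst z - X)))"
    using assms by (intro no_creation_sub[OF sub cont C1_moving_profile continuous_on_moving_profile]) (auto intro: d)
  show "continuous_on closed_half_plane (\<lambda>z. u z - (E - D * fst z + k * (snd z - C * fst z - X)))"
    by (intro continuous_intros cont)
qed

text \<open>All slopes of the hat lie in \<open>{k..k'}\<close>, where \<open>H\<close> is below the line; so the moving hat is a smooth
subsolution.\<close>

lemma no_creation_hat:
  assumes "\<eta> > 0" "k \<le> k'" and below: "\<And>q. q \<in> {k..k'} \<Longrightarrow> H q \<le> C * q + D"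
  shows "no_creation T m (\<lambda>z. (E - D * fst z + smooth_hat k k' \<eta> (snd z - C * fst z - X)) - u z)"
    and "continuous_on closed_half_plane (\<lambda>z. (E - D * fst z + smooth_hat k k' \<eta> (snd z - C * fst z - X)) - u z)"
proof -
  note d = smooth_hat_has_derivative[OF assms(1), of k k']
  show "no_creation T m (\<lambda>z. (E - D * fst z + smooth_hat k k' \<eta> (snd z - C * fst z - X)) - u z)"
    using below[OF smooth_hat_deriv_between[OF assms(2,1)]]
    by (intro no_creation_super[OF super cont C1_moving_profile[OF d smooth_hat_deriv_continuous[OF assms(1)]]
        continuous_on_moving_profile[OF d]]) (simp add: algebra_simps)
  show "continuous_on closed_half_plane (\<lambda>z. (E - D * fst z + smooth_hat k k' \<eta> (snd z - C * fst z - X)) - u z)"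
    by (intro continuous_on_diff continuous_on_moving_profile[OF d] cont)
qed

text \<open>The chord of \<open>H\<close> between \<open>k\<close> and \<open>k'\<close> meets the vertical axis at \<open>D\<close>. At a late time \<open>T\<close> the solution
lies below a hat at some point and above the line of slope \<open>k'\<close> at a point further to the right, and
this pattern can be traced back to time \<open>0\<close>. There the boundedness of \<open>u\<close> confines its left member to the
right of a point that recedes with speed \<open>H k / k\<close>, and its right member to the left of a point that
recedes with speed \<open>H k' / k'\<close>. If \<open>D < 0\<close>, then \<open>H k / k < H k' / k'\<close>, and for large \<open>T\<close> the two members
could not be in order.\<close>

lemma chord_intercept_nonneg:
  assumes persist: "\<And>t. 0 \<le> t \<Longrightarrow> \<exists>x. u (t, x + h) - u (t, x) \<ge> k' * h + A"
    and h: "h > 0" and A: "A > 0" and k: "0 < k" "k < k'"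
    and ends: "H k = C * k + D" "H k' = C * k' + D"
    and below: "\<And>q. q \<in> {k..k'} \<Longrightarrow> H q \<le> C * q + D"
  shows "D \<ge> 0"
proof (rule ccontr)
  assume "\<not> D \<ge> 0"
  then have D: "D < 0" by simp
  have B: "B \<ge> 0" using bound'[of 0 0] by simp
  \<comment> \<open>the time at which the inequalities for the positions at time \<open>0\<close> become contradictory\<close>
  define T where "T = (B + A + B * (k + k') / (k' - k)) / (- D)"
  have "B * (k + k') / (k' - k) \<ge> 0" using B k by simp
  then have T: "T \<ge> 0" unfolding T_def using B A D by (intro divide_nonneg_pos) auto
  obtain x where x: "u (T, x + h) - u (T, x) \<ge> k' * h + A" using persist[OF T] by blast
  define e where "e = u (T, x) + A / 2"
  define E where "E = e + D * T"
  define X where "X = x - C * T"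
  define \<eta> where "\<eta> = A / (2 * (k' - k))"
  define m where "m = A / 4"
  have m: "m > 0" using A by (simp add: m_def)
  have \<eta>: "\<eta> > 0" using A k by (simp add: \<eta>_def)
  have e: "\<bar>e\<bar> \<le> B + A" using bound'[OF T, of x] A by (auto simp: e_def)
  define line where "line = (\<lambda>z. E - D * fst z + k' * (snd z - C * fst z - X))"
  define hat where "hat = (\<lambda>z. E - D * fst z + smooth_hat k k' \<eta> (snd z - C * fst z - X))"
  have hat_le: "hat z \<le> line z" "hat z \<le> E - D * fst z + k * (snd z - C * fst z - X)" for z
    using smooth_hat_le[of k k' \<eta>] k by (auto simp: hat_def line_def)
  define Y where "Y = \<bar>C\<bar> * T + \<bar>X\<bar>"
  have Y: "\<bar>C * t + X\<bar> \<le> Y" if "t \<in> {0..T}" for t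
  proof -
    have "\<bar>C * t\<bar> \<le> \<bar>C\<bar> * T" using that by (auto simp: abs_mult intro!: mult_left_mono)
    then show ?thesis unfolding Y_def by linarith
  qed
  define R0 where "R0 = Y + (2 * B + A) / k + \<bar>x\<bar>"
  define R where "R = R0 + 1 + (2 * B + A - D * T) / k'"
  have "Y \<ge> 0" using T by (auto simp: Y_def)
  moreover have "(2 * B + A) / k \<ge> 0" using A B k by simp
  moreover have "2 * B + A - D * T \<ge> 0" using A B mult_nonpos_nonneg[of D T] D T by linarith
  then have "(2 * B + A - D * T) / k' \<ge> 0" using k by simp
  ultimately have R: "R0 \<ge> \<bar>x\<bar>" "R0 \<ge> 0" "R > R0"
    unfolding R0_def R_def by linarith+
  have Dt: "- D * t \<ge> 0" "- D * t \<le> - D * T" if "t \<in> {0..T}" for t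
    using D that by (auto simp: mult_nonpos_nonneg)
  have hat_far: "hat (t, y) - u (t, y) < m" if "t \<in> {0..T}" "y \<le> - R0" for t y
  proof -
    have "y - C * t - X \<le> - ((2 * B + A) / k)" using Y[OF that(1)] that(2) unfolding R0_def by linarith
    then have "k * (y - C * t - X) \<le> k * - ((2 * B + A) / k)" using k by (intro mult_left_mono) auto
    also have "\<dots> = - (2 * B + A)" using k by simp
    finally have "hat (t, y) \<le> E - D * t - (2 * B + A)" using hat_le(2)[of "(t, y)"] by simp
    then show ?thesis using Dt[OF that(1)] e bound'[of t y] that(1) m unfolding E_def by auto
  qed
  have line_far: "u (t, y) - line (t, y) < m" if "t \<in> {0..T}" "y \<ge> R" for t y
  proof -
    have "y - C * t - X \<ge> (2 * B + A - D * T) / k'"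
      using Y[OF that(1)] that(2) A B k unfolding R_def R0_def
      by (smt (verit, ccfv_SIG) divide_nonneg_pos)
    then have "k' * (y - C * t - X) \<ge> k' * ((2 * B + A - D * T) / k')" using k by (intro mult_left_mono) auto
    also have "k' * ((2 * B + A - D * T) / k') = 2 * B + A - D * T" using k by simp
    finally show ?thesis using Dt[OF that(1)] e bound'[of t y] that(1) m unfolding line_def E_def by auto
  qed
  \<comment> \<open>Only two points matter here. The third function is a stationary spike at \<open>- R0\<close>, to the left of which the
    hat is below \<open>u\<close>, so that the statement on triples applies.\<close>
  obtain z1 z2 z3 where z: "z2 \<le> z3" "hat (0, z2) - u (0, z2) \<ge> m" "u (0, z3) - line (0, z3) \<ge> m"
  proof (rule ordered_triple_trace_back[of "\<lambda>z. m - \<bar>snd z + R0\<bar>" "\<lambda>z. hat z - u z" "\<lambda>z. u z - line z" T m R "- R0" x "x + h"])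
    show "no_creation T m (\<lambda>z. m - \<bar>snd z + R0\<bar>)"
      using no_creation_const[of T m "\<lambda>y. m - \<bar>y + R0\<bar>"] .
    show "no_creation T m (\<lambda>z. hat z - u z)" "continuous_on closed_half_plane (\<lambda>z. hat z - u z)"
      unfolding hat_def using no_creation_hat[OF \<eta> _ below] k by auto
    show "no_creation T m (\<lambda>z. u z - line z)" "continuous_on closed_half_plane (\<lambda>z. u z - line z)"
      unfolding line_def using no_creation_line[OF ends(2)] by auto
    show "m - \<bar>snd (t, y) + R0\<bar> < m \<or> hat (t, y) - u (t, y) < m" if "t \<in> {0..T}" for t y
      using hat_far[OF that, of y] by auto
    show "hat (t, y) - u (t, y) < m \<or> u (t, y) - line (t, y) < m" if "t \<in> {0..T}" for t y
      using hat_le(1)[of "(t, y)"] m by linarith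
    have xX: "x - C * T - X = 0" "x + h - C * T - X = h" by (auto simp: X_def)
    have "(k' - k) / 2 * \<eta> = A / 4"
      using k by (simp add: \<eta>_def divide_simps mult.commute) (simp add: algebra_simps)?
    then show "hat (T, x) - u (T, x) \<ge> m"
      using \<eta> by (simp add: hat_def xX smooth_hat_0 E_def e_def m_def)
    show "u (T, x + h) - line (T, x + h) \<ge> m"
      using x A by (simp add: line_def xX E_def e_def m_def)
  qed (use hat_far line_far R T h in \<open>auto intro!: continuous_intros\<close>)
  define v where "v = z2 - X"
  have v: "k * v > - B - E" "k' * v < B - E"
  proof -
    show "k * v > - B - E" using hat_le(2)[of "(0, z2)"] z(2) bound'[of 0 z2] m by (simp add: v_def)
    have "k' * v \<le> k' * (z3 - X)" using z(1) k by (simp add: v_def)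
    then show "k' * v < B - E" using z(3) bound'[of 0 z3] m by (simp add: line_def)
  qed
  have "k' * (- B - E) < k' * (k * v)" using v(1) k by (intro mult_strict_left_mono) auto
  also have "k' * (k * v) = k * (k' * v)" by simp
  also have "\<dots> < k * (B - E)" using v(2) k by (intro mult_strict_left_mono) auto
  finally have "(k' - k) * (- E) < B * (k + k')" by (simp add: algebra_simps)
  moreover have "- E \<ge> B * (k + k') / (k' - k)"
  proof -
    have "- D * T = B + A + B * (k + k') / (k' - k)" using D by (simp add: T_def)
    then show ?thesis using e unfolding E_def by linarith
  qed
  then have "(k' - k) * (- E) \<ge> (k' - k) * (B * (k + k') / (k' - k))" using k by (intro mult_left_mono) auto
  ultimately show False using k by simp
qed

text \<open>With slopes of opposite signs the hat is bounded above by its tip, and the level of the tip falls with speed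
\<open>D\<close>. Going back in time by \<open>T\<close> with \<open>D > 0\<close>, the tip rises by \<open>D * T\<close>, so that the part of the line of slope
\<open>k\<close> below the bound of \<open>u\<close> moves far to the right of the tip and that of the line of slope \<open>k'\<close> far to
its left. But in the traced pattern the point where \<open>u\<close> exceeds the former line is on the left of the
point where \<open>u\<close> exceeds the latter. The intermediate point, where \<open>u\<close> is below the hat, is what keeps
the outer two points in order.\<close>

lemma chord_intercept_nonpos:
  assumes persist: "\<And>t. 0 \<le> t \<Longrightarrow> \<exists>x y. x \<le> y \<and> y \<le> x + 1 \<and> u (t, y) - u (t, x) \<ge> \<omega>"
    and per: "\<And>t x. 0 \<le> t \<Longrightarrow> u (t, x + 1) = u (t, x)"
    and \<omega>: "\<omega> > 0" and k: "k < 0" "0 < k'" "- k \<le> \<omega> / 2" "k' \<le> \<omega> / 2"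
    and ends: "H k = C * k + D" "H k' = C * k' + D"
    and below: "\<And>q. q \<in> {k..k'} \<Longrightarrow> H q \<le> C * q + D"
  shows "D \<le> 0"
proof (rule ccontr)
  assume "\<not> D \<le> 0"
  then have D: "D > 0" by simp
  have B: "B \<ge> 0" using bound'[of 0 0] by simp
  define T where "T = (2 * B + \<omega>) / D"
  have T: "T \<ge> 0" using B \<omega> D by (auto simp: T_def intro!: divide_nonneg_pos add_nonneg_nonneg)
  obtain x y where xy: "x \<le> y" "y \<le> x + 1" "u (T, y) - u (T, x) \<ge> \<omega>" using persist[OF T] by blast
  define e where "e = u (T, x) + \<omega> / 4"
  define E where "E = e + D * T"
  define X where "X = x - C * T"
  define \<eta> where "\<eta> = \<omega> / (4 * (k' - k))"
  define m where "m = \<omega> / 8"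
  have m: "m > 0" using \<omega> by (simp add: m_def)
  have \<eta>: "\<eta> > 0" using \<omega> k by (simp add: \<eta>_def)
  have e: "\<bar>e\<bar> \<le> B + \<omega>" "e \<ge> - B" using bound'[OF T, of x] \<omega> by (auto simp: e_def)
  define line where "line = (\<lambda>l z. E - D * fst z + l * (snd z - C * fst z - X))"
  define hat where "hat = (\<lambda>z. E - D * fst z + smooth_hat k k' \<eta> (snd z - C * fst z - X))"
  have hat_le: "hat z \<le> line k z" "hat z \<le> line k' z" for z
    using smooth_hat_le[of k k' \<eta>] k by (auto simp: hat_def line_def)
  define Y where "Y = \<bar>C\<bar> * T + \<bar>X\<bar>"
  have Y: "\<bar>C * t + X\<bar> \<le> Y" if "t \<in> {0..T}" for t
  proof -
    have "\<bar>C * t\<bar> \<le> \<bar>C\<bar> * T" using that by (auto simp: abs_mult intro!: mult_left_mono)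
    then show ?thesis unfolding Y_def by linarith
  qed
  define R where "R = Y + (2 * B + \<omega>) / (- k) + (2 * B + \<omega>) / k'"
  have nn: "(2 * B + \<omega>) / (- k) \<ge> 0" "(2 * B + \<omega>) / k' \<ge> 0"
    using B \<omega> k by (auto intro!: divide_nonneg_pos divide_nonneg_neg simp del: divide_minus_right)
  have far: "u (t, y) - (E - D * t + q) < m" if "t \<in> {0..T}" "q \<ge> 2 * B + \<omega>" for t y q
  proof -
    have "D * t \<le> D * T" using D that by auto
    then show ?thesis using e bound'[of t y] that m unfolding E_def by auto
  qed
  \<comment> \<open>by periodicity the high point \<open>y\<close> is used on both sides of the low point \<open>x\<close>\<close>
  obtain z1 z2 z3 where z: "z1 \<le> z2" "z2 \<le> z3" "u (0, z1) - line k (0, z1) \<ge> m" "u (0, z3) - line k' (0, z3) \<ge> m"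
  proof (rule ordered_triple_trace_back[of "\<lambda>z. u z - line k z" "\<lambda>z. hat z - u z" "\<lambda>z. u z - line k' z" T m R "y - 1" x y])
    show "no_creation T m (\<lambda>z. hat z - u z)" "continuous_on closed_half_plane (\<lambda>z. hat z - u z)"
      unfolding hat_def using no_creation_hat[OF \<eta> _ below] k by auto
    show "no_creation T m (\<lambda>z. u z - line k z)" "continuous_on closed_half_plane (\<lambda>z. u z - line k z)"
      unfolding line_def using no_creation_line[OF ends(1)] by auto
    show "no_creation T m (\<lambda>z. u z - line k' z)" "continuous_on closed_half_plane (\<lambda>z. u z - line k' z)"
      unfolding line_def using no_creation_line[OF ends(2)] by auto
    show "u (t, y) - line k (t, y) < m \<or> hat (t, y) - u (t, y) < m" for t y
      using hat_le(1)[of "(t, y)"] m by linarith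
    show "hat (t, y) - u (t, y) < m \<or> u (t, y) - line k' (t, y) < m" for t y
      using hat_le(2)[of "(t, y)"] m by linarith
    show "u (t, y) - line k (t, y) < m" if "t \<in> {0..T}" "y \<le> - R" for t y
    proof -
      have "- (y - C * t - X) \<ge> (2 * B + \<omega>) / (- k)" using Y[OF that(1)] that(2) nn unfolding R_def by linarith
      then have "- k * ((2 * B + \<omega>) / (- k)) \<le> - k * - (y - C * t - X)" using k by (intro mult_left_mono) auto
      also have "- k * ((2 * B + \<omega>) / (- k)) = 2 * B + \<omega>" using k by simp
      also have "- k * - (y - C * t - X) = k * (y - C * t - X)" by (simp only: minus_mult_minus)
      finally show ?thesis using far[OF that(1)] by (simp add: line_def)
    qed
    show "u (t, y) - line k' (t, y) < m" if "t \<in> {0..T}" "y \<ge> R" for t y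
    proof -
      have "y - C * t - X \<ge> (2 * B + \<omega>) / k'" using Y[OF that(1)] that(2) nn unfolding R_def by linarith
      then have "k' * (y - C * t - X) \<ge> k' * ((2 * B + \<omega>) / k')" using k by (intro mult_left_mono) auto
      then have "k' * (y - C * t - X) \<ge> 2 * B + \<omega>" using k by simp
      then show ?thesis using far[OF that(1)] by (simp add: line_def)
    qed
    have xX: "x - C * T - X = 0" "y - C * T - X = y - x" "y - 1 - C * T - X = y - 1 - x" by (auto simp: X_def)
    have "(k' - k) / 2 * \<eta> = \<omega> / 8"
      using k by (simp add: \<eta>_def divide_simps mult.commute) (simp add: algebra_simps)?
    then show "hat (T, x) - u (T, x) \<ge> m"
      using \<eta> by (simp add: hat_def xX smooth_hat_0 E_def e_def m_def)
    have "k' * (y - x) \<le> k' * 1" using xy k by (intro mult_left_mono) auto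
    moreover have "u (T, y) - line k' (T, y) = u (T, y) - e - k' * (y - x)"
      by (simp add: line_def xX E_def)
    ultimately show "u (T, y) - line k' (T, y) \<ge> m"
      using xy(3) k(4) \<omega> unfolding e_def m_def by linarith
    have "- k * (x + 1 - y) \<le> - k * 1" using xy k by (intro mult_left_mono) auto
    moreover have "- k * (x + 1 - y) = k * (y - 1 - x)" by (simp add: algebra_simps)
    moreover have "u (T, y - 1) = u (T, y)" using per[OF T, of "y - 1"] by simp
    moreover have "u (T, y - 1) - line k (T, y - 1) = u (T, y - 1) - e - k * (y - 1 - x)"
      by (simp add: line_def xX E_def)
    ultimately show "u (T, y - 1) - line k (T, y - 1) \<ge> m"
      using xy(3) k(3) \<omega> unfolding e_def m_def by linarith
  qed (use T xy in auto)
  have "D * T = 2 * B + \<omega>" using D by (simp add: T_def)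
  then have E: "E > B" using e \<omega> unfolding E_def by linarith
  have "k * (z1 - X) < 0" using z(3) bound'[of 0 z1] m E by (simp add: line_def)
  then have "z1 > X" using k by (simp add: mult_less_0_iff)
  have "k' * (z3 - X) < 0" using z(4) bound'[of 0 z3] m E by (simp add: line_def)
  then have "z3 < X" using k by (simp add: mult_less_0_iff)
  then show False using \<open>z1 > X\<close> z by simp
qed

end

text \<open>If \<open>H q / q\<close> increased from \<open>p\<close> to \<open>q\<close>, then the line \<open>C * x - \<delta>\<close> with \<open>C\<close> between the two quotients and
\<open>\<delta>\<close> positive and small would lie above the graph at \<open>p\<close>, but below it at \<open>0\<close> and at \<open>q\<close>. Between its last
crossing before \<open>p\<close> and its first crossing after \<open>p\<close> it is a chord above the graph, and it has the
negative intercept \<open>- \<delta>\<close>.\<close>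

lemma slopes_from_origin_antimono:
  fixes H :: "real \<Rightarrow> real"
  assumes H: "continuous_on UNIV H" "H 0 = 0"
    and chord: "\<And>k l C D. 0 < k \<Longrightarrow> k < l \<Longrightarrow> l \<le> K \<Longrightarrow> H k = C * k + D \<Longrightarrow> H l = C * l + D \<Longrightarrow>
      (\<And>q. q \<in> {k..l} \<Longrightarrow> H q \<le> C * q + D) \<Longrightarrow> D \<ge> 0"
    and p: "0 < p" "p \<le> q" "q \<le> K"
  shows "H q / q \<le> H p / p"
proof (rule ccontr)
  assume "\<not> H q / q \<le> H p / p"
  then have less: "H p / p < H q / q" and pq: "p < q" using p by (cases "p = q"; auto)+
  define C where "C = (H p / p + H q / q) / 2"
  define \<delta> where "\<delta> = (C * p - H p) / 2"
  have C: "H p < C * p" "C * q < H q"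
    using less p by (auto simp: C_def field_simps)
  then have \<delta>: "\<delta> > 0" by (simp add: \<delta>_def)
  define g where "g x = H x - (C * x - \<delta>)" for x
  have g: "continuous_on S g" for S
    unfolding g_def by (intro continuous_intros continuous_on_subset[OF H(1)]) auto
  have g0: "g 0 > 0" and gq: "g q > 0" using C \<delta> H(2) by (auto simp: g_def)
  have gp: "g p < 0" using C by (simp add: g_def \<delta>_def field_simps)
  have cl: "compact ({c..d} \<inter> {x. 0 \<le> g x})" for c d
    by (intro compact_Int_closed closed_Collect_le g continuous_intros) auto
  have "0 \<in> {0..p} \<inter> {x. 0 \<le> g x}" "q \<in> {p..q} \<inter> {x. 0 \<le> g x}"
    using g0 gq p pq by auto
  then obtain k l where k: "k \<in> {0..p}" "0 \<le> g k" "\<And>x. x \<in> {0..p} \<Longrightarrow> 0 \<le> g x \<Longrightarrow> x \<le> k"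
    and l: "l \<in> {p..q}" "0 \<le> g l" "\<And>x. x \<in> {p..q} \<Longrightarrow> 0 \<le> g x \<Longrightarrow> l \<le> x"
    using compact_attains_sup[OF cl[of 0 p]] compact_attains_inf[OF cl[of p q]]
    by (metis (no_types, lifting) IntD1 IntD2 IntI empty_iff mem_Collect_eq)
  have kl: "k < p" "p < l" using k(1,2) l(1,2) gp by (cases "k = p"; cases "l = p"; auto)+
  have neg: "g x < 0" if "k < x" "x < l" for x
    using k(3)[of x] l(3)[of x] k(1) l(1) that by (cases "x \<le> p") force+
  obtain k' where k': "k \<le> k'" "k' \<le> p" "g k' = 0"
    using IVT2'[of g p 0 k] g k(2) gp kl by auto
  have "k' = k" using k(3)[of k'] k' k(1) by auto
  then have gk: "g k = 0" using k' by simp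
  obtain l' where l': "p \<le> l'" "l' \<le> l" "g l' = 0"
    using IVT'[of g p 0 l] g l(2) gp kl by auto
  have "l' = l" using l(3)[of l'] l' l(1) by auto
  then have gl: "g l = 0" using l' by simp
  have "k \<noteq> 0" using gk g0 by auto
  have "- \<delta> \<ge> 0"
  proof (rule chord[of k l C "- \<delta>"])
    show "H x \<le> C * x + - \<delta>" if "x \<in> {k..l}" for x
      using neg[of x] gk gl that by (cases "x = k"; cases "x = l") (auto simp: g_def)
  qed (use k(1) l(1) kl gk gl \<open>k \<noteq> 0\<close> p in \<open>auto simp: g_def\<close>)
  then show False using \<delta> by simp
qed

lemma bounded_solution_negate:
  assumes "bounded_solution H u B"
  shows "bounded_solution (\<lambda>p. - H (- p)) (\<lambda>z. - u z) B"
proof -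
  interpret bounded_solution H u B by fact
  show ?thesis
    by unfold_locales (use sub super cont bound in
        \<open>auto simp: visc_sub_uminus_iff visc_super_uminus_iff intro!: continuous_intros\<close>)
qed

lemma bounded_solution_reflect:
  assumes "bounded_solution H u B"
  shows "bounded_solution (\<lambda>p. H (- p)) (\<lambda>(t, x). u (t, - x)) B"
proof -
  interpret bounded_solution H u B by fact
  have "continuous_on closed_half_plane (\<lambda>(t, x). u (t, - x))"
    unfolding case_prod_unfold
    by (rule continuous_on_compose2[OF cont]) (auto intro!: continuous_intros simp: closed_half_plane_def)
  then show ?thesis
    using visc_sub_affine[OF sub, of "- 1" 0] visc_super_affine[OF super, of "- 1" 0] bound'
    by unfold_locales (auto simp: closed_half_plane_def)
qed

context bounded_solution
begin

text \<open>The reflection \<open>- u (t, - x)\<close> solves the equation with Hamiltonian \<open>- H\<close> and has the same increments. Hence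
\<open>H q / q\<close> is both nonincreasing and nondecreasing.\<close>

lemma linear_on_positive_slopes:
  assumes H: "continuous_on UNIV H" "H 0 = 0"
    and persist: "\<And>t. 0 \<le> t \<Longrightarrow> \<exists>x. u (t, x + h) - u (t, x) \<ge> K * h + A"
    and h: "h > 0" and A: "A > 0" and K: "K > 0"
  obtains c where "\<And>q. q \<in> {0..K} \<Longrightarrow> H q = c * q"
proof -
  define v where "v = (\<lambda>(t, x). - u (t, - x))"
  interpret neg: bounded_solution "\<lambda>p. - H p" v B
    using bounded_solution_negate[OF bounded_solution_reflect[OF bounded_solution_axioms]]
    by (simp add: v_def case_prod_unfold)
  have le: "l * h + A \<le> K * h + A" if "l \<le> K" for l
    using that h by simp
  have pu: "\<exists>x. u (t, x + h) - u (t, x) \<ge> l * h + A" if "0 \<le> t" "l \<le> K" for t l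
    using persist[OF that(1)] le[OF that(2)] by (meson order_trans)
  have pv: "\<exists>x. v (t, x + h) - v (t, x) \<ge> l * h + A" if tl: "0 \<le> t" "l \<le> K" for t l
  proof -
    obtain x where "u (t, x + h) - u (t, x) \<ge> l * h + A" using pu[OF tl] by blast
    then show ?thesis by (intro exI[of _ "- x - h"]) (simp add: v_def add.commute)
  qed
  have anti: "H q / q \<le> H p / p" if p: "0 < p" "p \<le> q" "q \<le> K" for p q
    by (rule slopes_from_origin_antimono[OF H _ p]) (rule chord_intercept_nonneg[OF pu h A])
  have mono: "- H q / q \<le> - H p / p" if p: "0 < p" "p \<le> q" "q \<le> K" for p q
    by (rule slopes_from_origin_antimono[OF _ _ _ p])
      (use H in \<open>auto intro!: continuous_intros intro: neg.chord_intercept_nonneg[OF pv h A]\<close>)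
  show thesis
  proof (rule that[of "H K / K"])
    fix q assume q: "q \<in> {0..K}"
    show "H q = H K / K * q"
    proof (cases "q = 0")
      case False
      then have "H q / q = H K / K" using anti[of q K] mono[of q K] q by auto
      then show ?thesis using False by (metis nonzero_eq_divide_eq)
    qed (use H in simp)
  qed
qed

text \<open>At a convex kink the chord over a small symmetric interval would lie above \<open>H\<close> and have a positive
intercept.\<close>

lemma kink_at_zero_concave:
  assumes persist: "\<And>t. 0 \<le> t \<Longrightarrow> \<exists>x y. x \<le> y \<and> y \<le> x + 1 \<and> u (t, y) - u (t, x) \<ge> \<omega>"
    and per: "\<And>t x. 0 \<le> t \<Longrightarrow> u (t, x + 1) = u (t, x)"
    and pos: "\<omega> > 0" "\<kappa> > 0"
    and lin: "\<And>q. q \<in> {0..\<kappa>} \<Longrightarrow> H q = c1 * q" "\<And>q. q \<in> {- \<kappa>..0} \<Longrightarrow> H q = c2 * q"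
  shows "c1 \<le> c2"
proof -
  define k where "k = min \<kappa> (\<omega> / 2)"
  define s where "s = (c1 - c2) / 2"
  have k: "k > 0" "k \<le> \<kappa>" "k \<le> \<omega> / 2" using pos by (auto simp: k_def)
  have c: "c1 = (c1 + c2) / 2 + s" "c2 = (c1 + c2) / 2 - s" by (simp_all add: s_def field_simps)
  show ?thesis
  proof (rule ccontr)
    assume "\<not> c1 \<le> c2"
    then have s: "s > 0" by (simp add: s_def)
    have H1: "H q = (c1 + c2) / 2 * q + s * q" if "q \<in> {0..\<kappa>}" for q
      using lin(1)[OF that] by (subst (asm) c) (simp add: distrib_right)
    have H2: "H q = (c1 + c2) / 2 * q + s * - q" if "q \<in> {- \<kappa>..0}" for q
      using lin(2)[OF that] by (subst (asm) c(2)) (simp add: left_diff_distrib)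
    have "s * k \<le> 0"
    proof (rule chord_intercept_nonpos[OF persist per pos(1), of "- k" k "(c1 + c2) / 2"])
      show "H q \<le> (c1 + c2) / 2 * q + s * k" if "q \<in> {- k..k}" for q
      proof (cases "q \<ge> 0")
        case True
        have "s * q \<le> s * k" using that s by (intro mult_left_mono) auto
        then show ?thesis using H1[of q] that True k by auto
      next
        case False
        have "s * - q \<le> s * k" using that s by (intro mult_left_mono) auto
        then show ?thesis using H2[of q] that False k by auto
      qed
    qed (use k H1[of k] H2[of "- k"] in auto)
    then show False using s k by (simp add: mult_le_0_iff)
  qed
qed

text \<open>By periodicity a persistent increase over the distance \<open>h\<close> is a persistent decrease over the
complementary distance, so the reflected solution also has persistent increments of some positive slope,
and \<open>H\<close> is linear on both sides of zero. The two slopes agree because the kink is concave for \<open>H\<close>, and also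
for \<open>- H\<close> by reflection.\<close>

lemma persistent_slope_imp_linear:
  assumes H: "continuous_on UNIV H" "H 0 = 0"
    and per: "\<And>t x. 0 \<le> t \<Longrightarrow> u (t, x + 1) = u (t, x)"
    and persist: "\<And>t. 0 \<le> t \<Longrightarrow> \<exists>x. u (t, x + h) - u (t, x) \<ge> K * h + A"
    and h: "h > 0" and A: "A > 0" and K: "K > 0"
  obtains s c where "s > 0" "\<And>q. q \<in> {- s..K} \<Longrightarrow> H q = c * q"
proof -
  have per_int: "u (t, x + of_int n) = u (t, x)" if "0 \<le> t" for t x n
  proof -
    interpret periodic_fun_simple' "\<lambda>x. u (t, x)" by unfold_locales (rule per[OF that])
    show ?thesis by (rule plus_of_int)
  qed
  obtain c1 where c1: "\<And>q. q \<in> {0..K} \<Longrightarrow> H q = c1 * q"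
    using linear_on_positive_slopes[OF H persist h A K] by blast
  \<comment> \<open>\<open>h + h'\<close> is an integer, so stepping by \<open>h'\<close> undoes stepping by \<open>h\<close>; \<open>s\<close> is chosen such that
    \<open>s * h' = K * h\<close>.\<close>
  define h' where "h' = of_int (\<lfloor>h\<rfloor> + 1) - h"
  have h': "h' > 0" unfolding h'_def by linarith
  define s where "s = K * h / h'"
  have s: "s > 0" using h h' K by (simp add: s_def)
  define v where "v = (\<lambda>(t, x). u (t, - x))"
  interpret refl: bounded_solution "\<lambda>p. H (- p)" v B
    unfolding v_def by (rule bounded_solution_reflect[OF bounded_solution_axioms])
  have pv: "\<exists>x. v (t, x + h') - v (t, x) \<ge> s * h' + A" if t: "0 \<le> t" for t
  proof -
    obtain x where x: "u (t, x + h) - u (t, x) \<ge> K * h + A" using persist[OF t] by blast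
    have "v (t, (- x - of_int (\<lfloor>h\<rfloor> + 1)) + h') - v (t, - x - of_int (\<lfloor>h\<rfloor> + 1))
        = u (t, x + h) - u (t, x + of_int (\<lfloor>h\<rfloor> + 1))"
      by (simp add: v_def h'_def algebra_simps)
    also have "\<dots> = u (t, x + h) - u (t, x)" by (simp only: per_int[OF t])
    also have "\<dots> \<ge> s * h' + A" using x h' by (simp add: s_def)
    finally show ?thesis by blast
  qed
  have cv: "continuous_on UNIV (\<lambda>p. H (- p))"
    by (rule continuous_on_compose2[OF H(1)]) (auto intro!: continuous_intros)
  obtain c2 where c2: "\<And>q. q \<in> {0..s} \<Longrightarrow> H (- q) = c2 * q"
    using refl.linear_on_positive_slopes[OF cv _ pv h' A s] H(2) by auto
  have c2': "H q = - c2 * q" if "q \<in> {- s..0}" for q using c2[of "- q"] that by simp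
  have osc: "\<exists>x y. x \<le> y \<and> y \<le> x + 1 \<and> u (t, y) - u (t, x) \<ge> A" if t: "0 \<le> t" for t
  proof -
    obtain x where x: "u (t, x + h) - u (t, x) \<ge> K * h + A" using persist[OF t] by blast
    have "u (t, x + frac h) = u (t, x + h)"
      using per_int[OF t, of "x + frac h" "\<lfloor>h\<rfloor>"] by (simp add: frac_def)
    moreover have "K * h > 0" using K h by simp
    ultimately have "u (t, x + frac h) - u (t, x) \<ge> A" using x by linarith
    then show ?thesis
      by (intro exI[of _ x] exI[of _ "x + frac h"]) (auto intro: less_imp_le[OF frac_lt_1])
  qed
  have osc': "\<exists>x y. x \<le> y \<and> y \<le> x + 1 \<and> (\<lambda>(t, x). - u (t, - x)) (t, y) - (\<lambda>(t, x). - u (t, - x)) (t, x) \<ge> A"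
    if t: "0 \<le> t" for t
  proof -
    obtain x y where "x \<le> y" "y \<le> x + 1" "u (t, y) - u (t, x) \<ge> A" using osc[OF t] by blast
    then show ?thesis by (intro exI[of _ "- y"] exI[of _ "- x"]) auto
  qed
  have per': "(\<lambda>(t, x). - u (t, - x)) (t, x + 1) = (\<lambda>(t, x). - u (t, - x)) (t, x)" if "0 \<le> t" for t x
    using per[OF that, of "- (x + 1)"] by simp
  interpret neg: bounded_solution "\<lambda>p. - H p" "\<lambda>(t, x). - u (t, - x)" B
    using bounded_solution_negate[OF bounded_solution_reflect[OF bounded_solution_axioms]]
    by (simp add: case_prod_unfold)
  have "c1 \<le> - c2"
    by (rule kink_at_zero_concave[OF osc per A, of "min s K"]) (use c1 c2' s K in auto)
  moreover have "- c1 \<le> c2"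
    by (rule neg.kink_at_zero_concave[OF osc' per' A, of "min s K"]) (use c1 c2' s K in auto)
  ultimately have "c1 = - c2" by simp
  show thesis
  proof (rule that[OF s, of c1])
    show "H q = c1 * q" if "q \<in> {- s..K}" for q
      using c1[of q] c2'[of q] \<open>c1 = - c2\<close> that by (cases "q \<ge> 0") auto
  qed
qed

end

section \<open>Travelling waves\<close>

lemma uniformly_continuous_on_subset:
  fixes f :: "'a::metric_space \<Rightarrow> 'b::metric_space"
  shows "uniformly_continuous_on S f \<Longrightarrow> T \<subseteq> S \<Longrightarrow> uniformly_continuous_on T f"
  unfolding uniformly_continuous_on_def by (meson subsetD)

lemma periodic_continuous_shift_int:
  assumes "p \<in> periodic_continuous"
  shows "p (x + of_int n) = p x"
proof -
  interpret periodic_fun_simple' p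
    by unfold_locales (use assms in \<open>auto simp: periodic_continuous_def\<close>)
  show ?thesis by (rule plus_of_int)
qed

lemma periodic_continuous_imp_continuous_on: "p \<in> periodic_continuous \<Longrightarrow> continuous_on S p"
  unfolding periodic_continuous_def using continuous_on_subset by blast

lemma periodic_continuous_modulus:
  assumes p: "p \<in> periodic_continuous" and "e > 0"
  obtains d where "d > 0" "\<And>x y. \<bar>x - y\<bar> < d \<Longrightarrow> \<bar>p x - p y\<bar> < e"
proof -
  have "uniformly_continuous_on {- 1..2} p"
    by (intro compact_uniformly_continuous periodic_continuous_imp_continuous_on p) simp
  then obtain d where d: "d > 0" "\<And>x y. x \<in> {- 1..2} \<Longrightarrow> y \<in> {- 1..2} \<Longrightarrow> \<bar>y - x\<bar> < d \<Longrightarrow> \<bar>p y - p x\<bar> < e"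
    unfolding uniformly_continuous_on_def dist_real_def using \<open>e > 0\<close> by meson
  show thesis
  proof (rule that[of "min d 1"])
    fix x y :: real assume xy: "\<bar>x - y\<bar> < min d 1"
    define n where "n = \<lfloor>x\<rfloor>"
    have "0 \<le> x - of_int n" "x - of_int n < 1" unfolding n_def by linarith+
    then have "\<bar>p (x - of_int n) - p (y - of_int n)\<bar> < e"
      using xy by (intro d(2)) auto
    then show "\<bar>p x - p y\<bar> < e"
      using periodic_continuous_shift_int[OF p, of x "- n"] periodic_continuous_shift_int[OF p, of y "- n"] by simp
  qed (use d in auto)
qed

lemma periodic_continuous_bounded:
  assumes p: "p \<in> periodic_continuous"
  obtains B where "\<And>x. \<bar>p x\<bar> \<le> B"
proof -
  have "compact (p ` {0..1})"
    by (intro compact_continuous_image periodic_continuous_imp_continuous_on p) simp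
  then obtain B where B: "\<forall>y\<in>p ` {0..1}. norm y \<le> B"
    by (meson compact_imp_bounded bounded_iff)
  have "\<bar>p x\<bar> \<le> B" for x
  proof -
    have "frac x \<in> {0..1}" by (simp add: less_imp_le[OF frac_lt_1])
    then have "\<bar>p (frac x)\<bar> \<le> B" using B by simp
    then show ?thesis
      using periodic_continuous_shift_int[OF p, of "frac x" "\<lfloor>x\<rfloor>"] by (simp add: frac_def)
  qed
  then show thesis by (rule that)
qed

lemma has_derivative_along_line:
  fixes \<phi> :: "real \<times> real \<Rightarrow> real"
  assumes "(\<phi> has_derivative (\<lambda>(h, k). a * h + b * k)) (at z)"
  shows "((\<lambda>r. \<phi> (z + r *\<^sub>R v)) has_real_derivative (a * fst v + b * snd v)) (at 0)"
proof -
  have d: "((\<lambda>r. z + r *\<^sub>R v) has_derivative (\<lambda>r. r *\<^sub>R v)) (at (0::real))"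
    by (auto intro!: derivative_eq_intros)
  have "((\<lambda>r. \<phi> (z + r *\<^sub>R v)) has_derivative (\<lambda>r. case r *\<^sub>R v of (h, k) \<Rightarrow> a * h + b * k)) (at 0)"
    by (rule has_derivative_compose[OF d]) (use assms in simp)
  then show ?thesis unfolding has_field_derivative_def
    by (rule has_derivative_eq_rhs) (auto simp: fun_eq_iff algebra_simps case_prod_unfold)
qed

lemma eventually_nhds_line:
  fixes z v :: "real \<times> real"
  assumes "\<forall>\<^sub>F w in nhds z. P w"
  shows "\<exists>d>0. \<forall>r. \<bar>r\<bar> < d \<longrightarrow> P (z + r *\<^sub>R v)"
proof -
  have "isCont (\<lambda>r. z + r *\<^sub>R v) 0" by (intro continuous_intros)
  then have "filterlim (\<lambda>r. z + r *\<^sub>R v) (nhds z) (nhds (0::real))"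
    using tendsto_at_iff_tendsto_nhds[of "\<lambda>r. z + r *\<^sub>R v" 0] by (simp add: isCont_def)
  from eventually_compose_filterlim[OF assms this] show ?thesis
    unfolding eventually_nhds_metric by (auto simp: dist_real_def)
qed

text \<open>The wave is constant along the direction \<open>(1, c)\<close>, in which the test function therefore has a local
minimum; in the direction of space it inherits the one-sided slope bounds of the profile.\<close>

lemma wave_touched_from_above:
  fixes c :: real
  assumes \<phi>: "C1_half_plane \<phi> \<phi>t \<phi>x" and z: "z \<in> half_plane"
    and touch: "\<forall>\<^sub>F w in nhds z. p (snd w - c * fst w) - \<phi> w \<le> p (snd z - c * fst z) - \<phi> z"
  shows "\<phi>t z + c * \<phi>x z = 0"
    and "(\<And>y1 y2. y1 < y2 \<Longrightarrow> p y2 - p y1 \<le> \<beta> * (y2 - y1)) \<Longrightarrow> \<phi>x z \<le> \<beta>"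
    and "(\<And>y1 y2. y1 < y2 \<Longrightarrow> \<alpha> * (y2 - y1) \<le> p y2 - p y1) \<Longrightarrow> \<alpha> \<le> \<phi>x z"
proof -
  have d: "(\<phi> has_derivative (\<lambda>(h, k). \<phi>t z * h + \<phi>x z * k)) (at z)"
    using \<phi> z by (auto simp: C1_half_plane_def)
  obtain d1 where d1: "d1 > 0" "\<And>r. \<bar>r\<bar> < d1 \<Longrightarrow>
      p (snd (z + r *\<^sub>R (1, c)) - c * fst (z + r *\<^sub>R (1, c))) - \<phi> (z + r *\<^sub>R (1, c)) \<le> p (snd z - c * fst z) - \<phi> z"
    using eventually_nhds_line[OF touch, of "(1, c)"] by blast
  have "((\<lambda>r. \<phi> (z + r *\<^sub>R (1, c))) has_real_derivative (\<phi>t z + c * \<phi>x z)) (at 0)"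
    using has_derivative_along_line[OF d, of "(1, c)"] by (simp add: mult.commute)
  then show "\<phi>t z + c * \<phi>x z = 0"
    by (rule DERIV_local_min[OF _ d1(1)]) (use d1(2) in \<open>auto simp: algebra_simps simp flip: zero_prod_def\<close>)
  obtain d2 where d2: "d2 > 0" "\<And>r. \<bar>r\<bar> < d2 \<Longrightarrow>
      p (snd z - c * fst z + r) - \<phi> (z + r *\<^sub>R (0, 1)) \<le> p (snd z - c * fst z) - \<phi> z"
    using eventually_nhds_line[OF touch, of "(0, 1)"] by (auto simp: algebra_simps)
  have dx: "((\<lambda>r. \<phi> (z + r *\<^sub>R (0, 1)) - l * r) has_real_derivative (\<phi>x z - l)) (at 0)" for l
    using has_derivative_along_line[OF d, of "(0, 1)"]
    by (auto intro!: derivative_eq_intros)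
  show "\<phi>x z \<le> \<beta>" if up: "\<And>y1 y2. y1 < y2 \<Longrightarrow> p y2 - p y1 \<le> \<beta> * (y2 - y1)"
  proof (rule ccontr)
    assume "\<not> \<phi>x z \<le> \<beta>"
    then obtain e where e: "e > 0" "\<And>h. 0 < h \<Longrightarrow> h < e \<Longrightarrow>
        \<phi> (z + (0 - h) *\<^sub>R (0, 1)) - \<beta> * (0 - h) < \<phi> (z + 0 *\<^sub>R (0, 1)) - \<beta> * 0"
      using DERIV_pos_inc_left[OF dx[of \<beta>]] by auto
    define h where "h = min e d2 / 2"
    have h: "0 < h" "h < e" "h < d2" using e(1) d2(1) by (auto simp: h_def)
    show False
      using e(2)[OF h(1,2)] d2(2)[of "- h"] h up[of "snd z - c * fst z - h" "snd z - c * fst z"] by (auto simp flip: zero_prod_def)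
  qed
  show "\<alpha> \<le> \<phi>x z" if low: "\<And>y1 y2. y1 < y2 \<Longrightarrow> \<alpha> * (y2 - y1) \<le> p y2 - p y1"
  proof (rule ccontr)
    assume "\<not> \<alpha> \<le> \<phi>x z"
    then obtain e where e: "e > 0" "\<And>h. 0 < h \<Longrightarrow> h < e \<Longrightarrow>
        \<phi> (z + (0 + h) *\<^sub>R (0, 1)) - \<alpha> * (0 + h) < \<phi> (z + 0 *\<^sub>R (0, 1)) - \<alpha> * 0"
      using DERIV_neg_dec_right[OF dx[of \<alpha>]] by auto
    define h where "h = min e d2 / 2"
    have h: "0 < h" "h < e" "h < d2" using e(1) d2(1) by (auto simp: h_def)
    show False
      using e(2)[OF h(1,2)] d2(2)[of h] h low[of "snd z - c * fst z" "snd z - c * fst z + h"] by (auto simp flip: zero_prod_def)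
  qed
qed

lemma one_sided_Lipschitz_upperD:
  assumes "one_sided_Lipschitz a b p" "b = ereal \<beta>" "y1 < y2"
  shows "p y2 - p y1 \<le> \<beta> * (y2 - y1)"
  using assms unfolding one_sided_Lipschitz_def by (metis ereal_less_eq(3) times_ereal.simps(1))

lemma one_sided_Lipschitz_lowerD:
  assumes "one_sided_Lipschitz a b p" "a = ereal \<alpha>" "y1 < y2"
  shows "\<alpha> * (y2 - y1) \<le> p y2 - p y1"
  using assms unfolding one_sided_Lipschitz_def by (metis ereal_less_eq(3) times_ereal.simps(1))

text \<open>Where a test function touches the wave, its slope \<open>q\<close> satisfies \<open>a \<le> q \<le> b\<close>, and there the equation is the
transport equation with speed \<open>c\<close>.\<close>

lemma travelling_wave_solution:
  assumes p: "one_sided_Lipschitz a b p" and ab: "a \<le> 0" "0 \<le> b"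
    and H: "\<And>q. a \<le> ereal q \<Longrightarrow> ereal q \<le> b \<Longrightarrow> H q = c * q"
  shows "visc_sub H (\<lambda>z. p (snd z - c * fst z))" "visc_super H (\<lambda>z. p (snd z - c * fst z))"
proof -
  have le_b: "ereal q \<le> b" if "\<And>\<beta>. (\<And>y1 y2. y1 < y2 \<Longrightarrow> p y2 - p y1 \<le> \<beta> * (y2 - y1)) \<Longrightarrow> q \<le> \<beta>" for q
    using that one_sided_Lipschitz_upperD[OF p] ab by (cases b) auto
  have ge_a: "a \<le> ereal q" if "\<And>\<alpha>. (\<And>y1 y2. y1 < y2 \<Longrightarrow> \<alpha> * (y2 - y1) \<le> p y2 - p y1) \<Longrightarrow> \<alpha> \<le> q" for q
    using that one_sided_Lipschitz_lowerD[OF p] ab by (cases a) auto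
  show "visc_sub H (\<lambda>z. p (snd z - c * fst z))"
  proof (rule visc_subI)
    fix \<phi> \<phi>t \<phi>x and z :: "real \<times> real"
    assume t: "C1_half_plane \<phi> \<phi>t \<phi>x" "z \<in> half_plane"
      "\<forall>\<^sub>F w in nhds z. p (snd w - c * fst w) - \<phi> w \<le> p (snd z - c * fst z) - \<phi> z"
    note w = wave_touched_from_above[OF t]
    have "H (\<phi>x z) = c * \<phi>x z" by (rule H; rule le_b ge_a; rule w; assumption)
    then show "\<phi>t z + H (\<phi>x z) \<le> 0" using w(1) by simp
  qed
  have "visc_sub (\<lambda>p. - H (- p)) (\<lambda>z. - p (snd z - c * fst z))"
  proof (rule visc_subI)
    fix \<phi> \<phi>t \<phi>x and z :: "real \<times> real"
    assume t: "C1_half_plane \<phi> \<phi>t \<phi>x" "z \<in> half_plane"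
      "\<forall>\<^sub>F w in nhds z. - p (snd w - c * fst w) - \<phi> w \<le> - p (snd z - c * fst z) - \<phi> z"
    note w = wave_touched_from_above[where p = "\<lambda>y. - p y", OF t]
    have "a \<le> ereal (- \<phi>x z)"
    proof (rule ge_a)
      fix \<alpha> assume *: "\<And>y1 y2. y1 < y2 \<Longrightarrow> \<alpha> * (y2 - y1) \<le> p y2 - p y1"
      have "\<phi>x z \<le> - \<alpha>" by (rule w(2)) (use * in \<open>force simp: algebra_simps\<close>)
      then show "\<alpha> \<le> - \<phi>x z" by simp
    qed
    moreover have "ereal (- \<phi>x z) \<le> b"
    proof (rule le_b)
      fix \<beta> assume *: "\<And>y1 y2. y1 < y2 \<Longrightarrow> p y2 - p y1 \<le> \<beta> * (y2 - y1)"
      have "- \<beta> \<le> \<phi>x z" by (rule w(3)) (use * in \<open>force simp: algebra_simps\<close>)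
      then show "- \<phi>x z \<le> \<beta>" by simp
    qed
    ultimately have "H (- \<phi>x z) = c * - \<phi>x z" by (rule H)
    then show "\<phi>t z + - H (- \<phi>x z) \<le> 0" using w(1) by simp
  qed
  then show "visc_super H (\<lambda>z. p (snd z - c * fst z))"
    using visc_sub_uminus_iff[of H "\<lambda>z. p (snd z - c * fst z)"] by simp
qed

lemma linear_between_closed:
  assumes H: "continuous_on UNIV H" and lin: "linear_between H c a b" and ab: "a < b"
    and q: "a \<le> ereal q" "ereal q \<le> b"
  shows "H q = c * q"
proof -
  obtain w where w: "a < ereal w" "ereal w < b" using ereal_dense2[OF ab] by blast
  define S where "S = {v. H v = c * v}"
  have "closed S" unfolding S_def by (intro closed_Collect_eq H continuous_intros)
  have strict: "a < ereal v \<and> ereal v < b" if "v \<in> open_segment q w" for v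
  proof -
    have "min q w < v" "v < max q w" using that by (auto simp: open_segment_eq_real_ivl split: if_splits)
    then have "ereal (min q w) < ereal v" "ereal v < ereal (max q w)" by (simp_all only: less_ereal.simps)
    moreover have "a \<le> ereal (min q w)" "ereal (max q w) \<le> b" using q w by (auto simp: min_def max_def)
    ultimately show ?thesis by (meson le_less_trans less_le_trans)
  qed
  then have "open_segment q w \<subseteq> S" using lin by (auto simp: S_def linear_between_def)
  then have "closure (open_segment q w) \<subseteq> S" using \<open>closed S\<close> by (rule closure_minimal)
  moreover have "w \<in> S" using lin w by (auto simp: S_def linear_between_def)
  ultimately have "q \<in> S" by (cases "q = w") (auto simp: closure_open_segment)
  then show ?thesis by (simp add: S_def)
qed

lemma BUC_loc_affine:
  assumes u: "u \<in> BUC_loc" and \<sigma>: "\<sigma> * \<sigma> = (1::real)"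
  shows "(\<lambda>(t, x). u (t, \<sigma> * x + h)) \<in> BUC_loc"
proof -
  define A where "A = (\<lambda>z::real \<times> real. (fst z, \<sigma> * snd z + h))"
  have eq: "(\<lambda>(t, x). u (t, \<sigma> * x + h)) = u \<circ> A" by (auto simp: A_def fun_eq_iff)
  have "\<sigma>\<^sup>2 = 1" using \<sigma> by (simp add: power2_eq_square)
  then have "\<bar>\<sigma>\<bar> = 1" by (metis abs_1 abs_power2 power2_eq_1_iff abs_minus_cancel)
  then have dist: "dist (A z) (A w) = dist z w" for z w
    by (simp add: A_def dist_prod_def dist_real_def abs_mult flip: right_diff_distrib)
  have A: "uniformly_continuous_on S A" for S
    unfolding uniformly_continuous_on_def dist by blast
  have sub: "A ` ({0..<T} \<times> UNIV) \<subseteq> {0..<T} \<times> UNIV" for T by (auto simp: A_def)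
  have "bounded ((u \<circ> A) ` ({0..<T} \<times> UNIV)) \<and> uniformly_continuous_on ({0..<T} \<times> UNIV) (u \<circ> A)" if "T > 0" for T
  proof
    have *: "bounded (u ` ({0..<T} \<times> UNIV))" "uniformly_continuous_on ({0..<T} \<times> UNIV) u"
      using u that by (auto simp: BUC_loc_def)
    show "bounded ((u \<circ> A) ` ({0..<T} \<times> UNIV))"
      unfolding image_comp[symmetric] by (rule bounded_subset[OF *(1)]) (use sub in blast)
    show "uniformly_continuous_on ({0..<T} \<times> UNIV) (u \<circ> A)"
      using uniformly_continuous_on_compose[OF A uniformly_continuous_on_subset[OF *(2) sub]]
      by (simp add: o_def)
  qed
  moreover have "continuous_on closed_half_plane (u \<circ> A)"
    using u by (intro continuous_on_compose uniformly_continuous_imp_continuous[OF A])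
      (auto simp: BUC_loc_def closed_half_plane_def A_def intro: continuous_on_subset)
  ultimately show ?thesis unfolding eq by (simp add: BUC_loc_def)
qed

lemma travelling_wave_BUC_loc:
  assumes p: "p \<in> periodic_continuous"
  shows "(\<lambda>z. p (snd z - c * fst z)) \<in> BUC_loc"
proof -
  obtain B where B: "\<And>x. \<bar>p x\<bar> \<le> B" using periodic_continuous_bounded[OF p] by blast
  have bl: "bounded_linear (\<lambda>z::real\<times>real. snd z - c * fst z)"
    by (intro bounded_linear_sub bounded_linear_snd bounded_linear_const_mult bounded_linear_fst)
  have "uniformly_continuous_on UNIV p"
    unfolding uniformly_continuous_on_def dist_real_def
    by (metis periodic_continuous_modulus[OF p])
  then have uc: "uniformly_continuous_on S (\<lambda>z. p (snd z - c * fst z))" for S :: "(real \<times> real) set"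
    using uniformly_continuous_on_compose[OF bounded_linear.uniformly_continuous_on[OF bl uniformly_continuous_on_id], of S p]
    by (auto simp: o_def intro: uniformly_continuous_on_subset)
  then have "continuous_on closed_half_plane (\<lambda>z. p (snd z - c * fst z))"
    using uniformly_continuous_imp_continuous by blast
  moreover have "bounded ((\<lambda>z. p (snd z - c * fst z)) ` S)" for S
    using B by (auto simp: bounded_iff)
  ultimately show ?thesis using uc by (simp add: BUC_loc_def)
qed

section \<open>Convergence to a travelling wave\<close>

locale periodic_cauchy_problem =
  fixes H u0 :: "real \<Rightarrow> real" and u :: "real \<times> real \<Rightarrow> real"
  assumes H: "continuous_on UNIV H" "H 0 = 0"
    and u0: "u0 \<in> periodic_continuous" and sol: "viscosity_solution H u0 u"
begin

lemma u_sub: "visc_sub H u" and u_super: "visc_super H u" and u_BUC: "u \<in> BUC_loc"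
  using sol by (auto simp: viscosity_solution_def viscosity_subsolution_def
      viscosity_supersolution_def visc_sub_def visc_super_def)

lemma u_initial: "u (0, x) = u0 x"
  using sol by (auto simp: viscosity_solution_def viscosity_subsolution_def
      viscosity_supersolution_def intro: order_antisym)

text \<open>Comparison of \<open>u\<close> with its own translate.\<close>

lemma increment_bound_propagates:
  assumes "0 \<le> t1" "t1 \<le> t2" "\<And>x. u (t1, x + h) - u (t1, x) \<le> m"
  shows "u (t2, x + h) - u (t2, x) \<le> m"
  using comparison_principle[OF H(1) _ _ u_super u_BUC assms(1,2), of "\<lambda>(t, x). u (t, 1 * x + h)" m x]
    visc_sub_affine[OF u_sub, of 1 h] BUC_loc_affine[OF u_BUC, of 1 h] assms(3) by simp

lemma u_periodic:
  assumes "0 \<le> t"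
  shows "u (t, x + 1) = u (t, x)"
proof -
  have p1: "u0 (x + 1) = u0 x" for x using u0 by (simp add: periodic_continuous_def)
  have "u (t, x + 1) - u (t, x) \<le> 0" for x
    by (rule increment_bound_propagates[of 0]) (use assms in \<open>auto simp: u_initial p1\<close>)
  moreover have "u (t, x + - 1) - u (t, x) \<le> 0" for x
    by (rule increment_bound_propagates[of 0]) (use assms p1[of "x - 1" for x] in \<open>auto simp: u_initial\<close>)
  from this[of "x + 1"] have "u (t, x) \<le> u (t, x + 1)" by simp
  ultimately show ?thesis by (meson diff_le_0_iff_le order_antisym)
qed

lemma u_periodic_int: "0 \<le> t \<Longrightarrow> u (t, x + of_int n) = u (t, x)"
proof -
  assume t: "0 \<le> t"
  interpret periodic_fun_simple' "\<lambda>x. u (t, x)" by unfold_locales (rule u_periodic[OF t])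
  show ?thesis by (rule plus_of_int)
qed

lemma u_equicontinuous:
  assumes "e > 0"
  obtains d where "d > 0" "\<And>t x y. 0 \<le> t \<Longrightarrow> \<bar>x - y\<bar> < d \<Longrightarrow> \<bar>u (t, x) - u (t, y)\<bar> \<le> e"
proof -
  obtain d where d: "d > 0" "\<And>x y. \<bar>x - y\<bar> < d \<Longrightarrow> \<bar>u0 x - u0 y\<bar> < e"
    using periodic_continuous_modulus[OF u0 assms] by blast
  have inc: "u (t, y) - u (t, x) \<le> e" if "0 \<le> t" "\<bar>x - y\<bar> < d" for t x y
  proof -
    have "\<bar>u0 (z + (y - x)) - u0 z\<bar> < e" for z
      by (rule d(2)) (use that in \<open>simp add: abs_minus_commute\<close>)
    then have inc0: "u0 (z + (y - x)) - u0 z \<le> e" for z by (meson abs_ge_self le_less_trans less_imp_le)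
    have "u (t, x + (y - x)) - u (t, x) \<le> e"
      by (rule increment_bound_propagates[of 0]) (use that inc0 in \<open>auto simp: u_initial\<close>)
    then show ?thesis by simp
  qed
  show thesis
    by (rule that[OF d(1)]) (use inc in \<open>fastforce simp: abs_le_iff abs_minus_commute\<close>)
qed

lemma wave_distance_propagates:
  assumes p: "p \<in> periodic_continuous" "one_sided_Lipschitz a b p" and ab: "a \<le> 0" "0 \<le> b"
    and lin: "\<And>q. a \<le> ereal q \<Longrightarrow> ereal q \<le> b \<Longrightarrow> H q = c * q"
    and t: "0 \<le> t1" "t1 \<le> t2" and close: "\<And>x. \<bar>u (t1, x) - p (x - c * t1)\<bar> \<le> e"
  shows "\<bar>u (t2, x) - p (x - c * t2)\<bar> \<le> e"
proof -
  note w = travelling_wave_solution[OF p(2) ab lin] travelling_wave_BUC_loc[OF p(1), of c]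
  have "u (t2, x) - (\<lambda>z. p (snd z - c * fst z)) (t2, x) \<le> e"
    by (rule comparison_principle[OF H(1) u_sub u_BUC w(2,3) t]) (use close in \<open>auto simp: abs_le_iff\<close>)
  moreover have "(\<lambda>z. p (snd z - c * fst z)) (t2, x) - u (t2, x) \<le> e"
    by (rule comparison_principle[OF H(1) w(1,3) u_super u_BUC t]) (use close in \<open>auto simp: abs_le_iff\<close>)
  ultimately show ?thesis by (auto simp: abs_le_iff)
qed

lemma u_bounded: obtains B where "bounded_solution H u B"
proof -
  obtain B where B: "\<And>x. \<bar>u0 x\<bar> \<le> B" using periodic_continuous_bounded[OF u0] by blast
  have "\<bar>u z\<bar> \<le> B" if "z \<in> closed_half_plane" for z
  proof -
    obtain t x where tx: "z = (t, x)" by (cases z)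
    then have z: "z = (t, x)" "0 \<le> t" using that by (auto simp: closed_half_plane_def)
    \<comment> \<open>the zero function is a travelling wave, as \<open>H 0 = 0\<close>\<close>
    have "\<bar>u (t, x) - (\<lambda>y. 0) (x - 0 * t)\<bar> \<le> B"
      by (rule wave_distance_propagates[of "\<lambda>y. 0" 0 0 0 0])
        (use B z H in \<open>auto simp: u_initial periodic_continuous_def one_sided_Lipschitz_def zero_ereal_def\<close>)
    then show ?thesis by (simp add: z)
  qed
  then show thesis
    using u_BUC by (intro that) (unfold_locales, auto simp: u_sub u_super BUC_loc_def)
qed

text \<open>The functions \<open>u (n, x + c * n)\<close> are periodic and bounded, and they keep the modulus of continuity of the
initial function.\<close>

lemma limit_profile:
  obtains p r where "p \<in> periodic_continuous" "strict_mono (r :: nat \<Rightarrow> nat)"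
    "\<And>e. e > 0 \<Longrightarrow> \<exists>N. \<forall>n\<ge>N. \<forall>x. \<bar>u (real (r n), x + c * real (r n)) - p x\<bar> < e"
proof -
  define F where "F n x = u (real n, x + c * real n)" for n x
  obtain B where "bounded_solution H u B" using u_bounded by blast
  then interpret bounded_solution H u B .
  have Fper: "F n (x + of_int k) = F n x" for n x k
    using u_periodic_int[of "real n" "x + c * real n" k] by (simp add: F_def ac_simps)
  have eq: "\<exists>d>0. \<forall>n x y. \<bar>x - y\<bar> < d \<longrightarrow> \<bar>F n x - F n y\<bar> < e" if "e > 0" for e
  proof -
    obtain d where "d > 0" "\<And>t x y. 0 \<le> t \<Longrightarrow> \<bar>x - y\<bar> < d \<Longrightarrow> \<bar>u (t, x) - u (t, y)\<bar> \<le> e / 2"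
      using u_equicontinuous[of "e / 2"] \<open>e > 0\<close> by auto
    moreover have "\<bar>F n x - F n y\<bar> < e" if "\<bar>F n x - F n y\<bar> \<le> e / 2" for n x y
      using that \<open>e > 0\<close> by linarith
    ultimately show ?thesis unfolding F_def
      by (intro exI[of _ d]) (auto simp: F_def)
  qed
  obtain g r where r: "strict_mono (r :: nat \<Rightarrow> nat)"
    and lim: "\<And>e. 0 < e \<Longrightarrow> \<exists>N. \<forall>n x. n \<ge> N \<and> x \<in> {0..1} \<longrightarrow> norm (F (r n) x - g x) < e"
  proof (rule Arzela_Ascoli[of "{0..1::real}" F B])
    show "norm (F n x) \<le> B" for n x using bound'[of "real n"] by (simp add: F_def)
    show "\<exists>d. 0 < d \<and> (\<forall>n y. y \<in> {0..1} \<and> norm (x - y) < d \<longrightarrow> norm (F n x - F n y) < e)" if "0 < e" for x e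
      using eq[OF that] by (metis real_norm_def)
  qed (auto intro: that)
  define p where "p x = g (frac x)" for x
  have conv: "\<exists>N. \<forall>n\<ge>N. \<forall>x. \<bar>F (r n) x - p x\<bar> < e" if e: "e > 0" for e
  proof -
    obtain N where N: "\<And>n x. n \<ge> N \<Longrightarrow> x \<in> {0..1} \<Longrightarrow> \<bar>F (r n) x - g x\<bar> < e"
      using lim[OF e] by auto
    have Ffrac: "F (r n) x = F (r n) (frac x)" for n x
      using Fper[of "r n" "frac x" "\<lfloor>x\<rfloor>"] by (simp add: frac_def)
    have "\<bar>F (r n) x - p x\<bar> < e" if "n \<ge> N" for n x
      using N[OF that, of "frac x"] unfolding p_def Ffrac[of n x]
      by (simp add: less_imp_le[OF frac_lt_1])
    then show ?thesis by blast
  qed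
  have "p \<in> periodic_continuous"
  proof -
    have "uniform_limit UNIV (\<lambda>n. F (r n)) p sequentially"
      unfolding uniform_limit_iff eventually_sequentially dist_real_def using conv by auto
    moreover have "continuous_on UNIV (F n)" for n
      unfolding continuous_on_iff dist_real_def using eq by (metis UNIV_I)
    ultimately have "continuous_on UNIV p"
      by (intro uniform_limit_theorem[where F = sequentially]) auto
    moreover have "p (x + 1) = p x" for x using frac_unique_iff[of "x + 1" "frac x"]
      by (simp add: p_def frac_def)
    ultimately show ?thesis by (simp add: periodic_continuous_def)
  qed
  then show thesis using r conv by (intro that) (auto simp: F_def)
qed

text \<open>If all increments over the distance \<open>h\<close> were at most \<open>\<mu>\<close> at some time, they would remain so at all later
times, and hence also for the limit profile.\<close>

lemma profile_increment_persists:
  assumes p: "\<And>e. e > 0 \<Longrightarrow> \<exists>N. \<forall>n\<ge>N. \<forall>x. \<bar>u (real (r n), x + c * real (r n)) - p x\<bar> < e"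
    and r: "strict_mono (r :: nat \<Rightarrow> nat)" and inc: "p (y + h) - p y > \<mu>" and t: "0 \<le> t"
  shows "\<exists>x. u (t, x + h) - u (t, x) \<ge> \<mu>"
proof (rule ccontr)
  assume "\<nexists>x. u (t, x + h) - u (t, x) \<ge> \<mu>"
  then have *: "u (t, x + h) - u (t, x) \<le> \<mu>" for x by (meson linear)
  define e where "e = (p (y + h) - p y - \<mu>) / 2"
  have "e > 0" using inc by (simp add: e_def)
  then obtain N where N: "\<And>n x. n \<ge> N \<Longrightarrow> \<bar>u (real (r n), x + c * real (r n)) - p x\<bar> < e" using p by blast
  define n where "n = max N (nat \<lceil>t\<rceil>)"
  have "t \<le> real (nat \<lceil>t\<rceil>)" by (rule real_nat_ceiling_ge)
  also have "\<dots> \<le> real n" by (simp add: n_def)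
  also have "\<dots> \<le> real (r n)" using seq_suble[OF r, of n] by simp
  finally have "u (real (r n), (y + c * real (r n)) + h) - u (real (r n), y + c * real (r n)) \<le> \<mu>"
    by (rule increment_bound_propagates[OF t _ *])
  moreover have "\<bar>u (real (r n), y + h + c * real (r n)) - p (y + h)\<bar> < e"
    "\<bar>u (real (r n), y + c * real (r n)) - p y\<bar> < e" by (intro N; simp add: n_def)+
  moreover have "2 * e = p (y + h) - p y - \<mu>" by (simp add: e_def)
  moreover have "y + h + c * real (r n) = y + c * real (r n) + h" by simp
  ultimately show False by (smt (verit))
qed

end

theorem theorem5:
  fixes H u0 :: "real \<Rightarrow> real" and u :: "real \<times> real \<Rightarrow> real" and a b :: ereal
  assumes "continuous_on UNIV H" and "H 0 = 0"
    and "linearity_bounds H a b"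
    and "u0 \<in> periodic_continuous"
    and "viscosity_solution H u0 u"
  shows "\<exists>p\<in>periodic_continuous. \<exists>c.
           uniform_limit UNIV (\<lambda>t x. u (t, x) - p (x - c * t)) (\<lambda>x. 0) at_top \<and>
           one_sided_Lipschitz a b p \<and>
           linear_between H c a b \<and>
           (a = 0 \<and> b = 0 \<longrightarrow>
              (\<exists>p0. (\<forall>y. p y = p0) \<and>
                    uniform_limit UNIV (\<lambda>t x. u (t, x)) (\<lambda>x. p0) at_top) \<and>
              (\<forall>c'. uniform_limit UNIV (\<lambda>t x. u (t, x) - p (x - c' * t)) (\<lambda>x. 0) at_top))"
proof -
  interpret periodic_cauchy_problem H u0 u
    using assms by unfold_locales
  obtain B where "bounded_solution H u B" using u_bounded by blast
  then interpret bounded_solution H u B .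
  have ab: "a \<le> 0" "0 \<le> b"
    using assms(3) by (auto simp: linearity_bounds_def maximal_linear_nbhd_def)
  have "\<exists>c. linear_between H c a b \<and> (\<forall>q. a \<le> ereal q \<longrightarrow> ereal q \<le> b \<longrightarrow> H q = c * q)"
  proof (cases "maximal_linear_nbhd H a b")
    case True
    then obtain c where "linear_between H c a b" "a < b"
      unfolding maximal_linear_nbhd_def by (meson less_trans)
    then show ?thesis using linear_between_closed[OF assms(1)] by blast
  next
    case False
    then have "a = 0" "b = 0" using assms(3) by (auto simp: linearity_bounds_def)
    then show ?thesis using assms(2) by (intro exI[of _ 0]) (auto simp: linear_between_def zero_ereal_def)
  qed
  then obtain c where c: "linear_between H c a b"
    and cl: "\<And>q. a \<le> ereal q \<Longrightarrow> ereal q \<le> b \<Longrightarrow> H q = c * q" by blast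
  obtain p r where p: "p \<in> periodic_continuous" and r: "strict_mono (r :: nat \<Rightarrow> nat)"
    and conv: "\<And>e. e > 0 \<Longrightarrow> \<exists>N. \<forall>n\<ge>N. \<forall>x. \<bar>u (real (r n), x + c * real (r n)) - p x\<bar> < e"
    using limit_profile[of c] by blast
  have largest: "a \<le> ereal a' \<and> ereal b' \<le> b"
    if "a' < 0" "0 < b'" "\<And>q. q \<in> {a'..b'} \<Longrightarrow> H q = c' * q" for a' b' c'
  proof -
    have "linear_between H c' (ereal a') (ereal b')" using that(3) by (auto simp: linear_between_def)
    moreover have "ereal a' < 0" "0 < ereal b'" using that(1,2) by auto
    ultimately show ?thesis
      using assms(3) unfolding linearity_bounds_def maximal_linear_nbhd_def by blast
  qed
  have upper: "ereal (p y2 - p y1) \<le> b * ereal (y2 - y1)" if y: "y1 < y2" for y1 y2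
  proof (cases b)
    case (real \<beta>)
    define h where "h = y2 - y1"
    have h: "h > 0" "y2 = y1 + h" using y by (auto simp: h_def)
    show ?thesis
    proof (rule ccontr)
      assume "\<not> ?thesis"
      then have gt: "p (y1 + h) - p y1 > \<beta> * h" using real h by simp
      define A where "A = (p (y1 + h) - p y1 - \<beta> * h) / 4"
      define K where "K = \<beta> + A / h"
      have A: "A > 0" using gt by (simp add: A_def)
      have A4: "p (y1 + h) - p y1 = \<beta> * h + 4 * A" by (simp add: A_def diff_divide_distrib add_divide_distrib)
      have "\<beta> \<ge> 0" using ab real by simp
      then have K: "K > \<beta>" "K > 0" using A h by (auto simp: K_def add_nonneg_pos)
      have Kh: "K * h + A = \<beta> * h + 2 * A" using h by (simp add: K_def distrib_right left_diff_distrib)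
      then have gt': "p (y1 + h) - p y1 > K * h + A" using A A4 by linarith
      have pu: "\<exists>x. u (t, x + h) - u (t, x) \<ge> K * h + A" if "0 \<le> t" for t
        by (rule profile_increment_persists[OF conv r gt' that])
      obtain s c0 where "s > 0" "\<And>q. q \<in> {- s..K} \<Longrightarrow> H q = c0 * q"
        using persistent_slope_imp_linear[OF assms(1,2) u_periodic pu h(1) A K(2)] by blast
      then show False using largest[of "- s" K c0] K real by simp
    qed
  qed (use y ab in auto)
  have lower: "a * ereal (y2 - y1) \<le> ereal (p y2 - p y1)" if y: "y1 < y2" for y1 y2
  proof (cases a)
    case (real \<alpha>)
    define h where "h = y2 - y1"
    have h: "h > 0" "y1 = y2 + - h" using y by (auto simp: h_def)
    show ?thesis
    proof (rule ccontr)
      assume "\<not> ?thesis"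
      then have gt: "p (y2 + - h) - p y2 > - \<alpha> * h" using real h by simp
      define A where "A = (p (y2 + - h) - p y2 - - \<alpha> * h) / 4"
      define K where "K = - \<alpha> + A / h"
      have A: "A > 0" using gt by (simp add: A_def)
      have A4: "p (y2 + - h) - p y2 = - \<alpha> * h + 4 * A" by (simp add: A_def diff_divide_distrib add_divide_distrib)
      have "\<alpha> \<le> 0" using ab real by simp
      moreover have "A / h > 0" using A h by simp
      ultimately have K: "K > - \<alpha>" "K > 0" unfolding K_def by linarith+
      have Kh: "K * h + A = - \<alpha> * h + 2 * A" using h by (simp add: K_def distrib_right left_diff_distrib)
      then have gt': "p (y2 + - h) - p y2 > K * h + A" using A A4 by linarith
      define v where "v = (\<lambda>(t, x). u (t, - x))"
      interpret refl: bounded_solution "\<lambda>p. H (- p)" v B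
        unfolding v_def by (rule bounded_solution_reflect[OF bounded_solution_axioms])
      have pv: "\<exists>x. v (t, x + h) - v (t, x) \<ge> K * h + A" if t: "0 \<le> t" for t
      proof -
        obtain x where "u (t, x + - h) - u (t, x) \<ge> K * h + A"
          using profile_increment_persists[OF conv r gt' t] by blast
        then show ?thesis by (intro exI[of _ "- x"]) (simp add: v_def)
      qed
      have cv: "continuous_on UNIV (\<lambda>p. H (- p))"
        by (rule continuous_on_compose2[OF assms(1)]) (auto intro!: continuous_intros)
      have perv: "v (t, x + 1) = v (t, x)" if "0 \<le> t" for t x
        using u_periodic[OF that, of "- (x + 1)"] by (simp add: v_def)
      obtain s c0 where s: "s > 0" "\<And>q. q \<in> {- s..K} \<Longrightarrow> H (- q) = c0 * q"
        using refl.persistent_slope_imp_linear[OF cv _ perv pv h(1) A K(2)] assms(2) by auto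
      have "H q = - c0 * q" if "q \<in> {- K..s}" for q using s(2)[of "- q"] that by simp
      then show False using largest[of "- K" s "- c0"] K s(1) real by simp
    qed
  qed (use y ab in auto)
  have Lip: "one_sided_Lipschitz a b p" using upper lower by (simp add: one_sided_Lipschitz_def)
  have main: "uniform_limit UNIV (\<lambda>t x. u (t, x) - p (x - c * t)) (\<lambda>x. 0) at_top"
    unfolding uniform_limit_iff eventually_at_top_linorder dist_real_def
  proof (intro allI impI)
    fix e :: real assume "e > 0"
    then obtain n where n: "\<And>x. \<bar>u (real (r n), x + c * real (r n)) - p x\<bar> < e / 2"
      using conv[of "e / 2"] by auto
    have "\<bar>u (real (r n), x) - p (x - c * real (r n))\<bar> \<le> e / 2" for x
      using n[of "x - c * real (r n)"] by simp
    from wave_distance_propagates[OF p Lip ab cl _ _ this]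
    have le: "\<bar>u (t, x) - p (x - c * t)\<bar> \<le> e / 2" if "t \<ge> real (r n)" for t x
      using that by simp
    have "\<bar>u (t, x) - p (x - c * t)\<bar> < e" if "t \<ge> real (r n)" for t x
      using le[OF that, of x] \<open>e > 0\<close> by linarith
    then show "\<exists>N. \<forall>t\<ge>N. \<forall>x\<in>UNIV. \<bar>u (t, x) - p (x - c * t) - 0\<bar> < e"
      by (intro exI[of _ "real (r n)"]) simp
  qed
  have const: "(\<exists>p0. (\<forall>y. p y = p0) \<and> uniform_limit UNIV (\<lambda>t x. u (t, x)) (\<lambda>x. p0) at_top) \<and>
      (\<forall>c'. uniform_limit UNIV (\<lambda>t x. u (t, x) - p (x - c' * t)) (\<lambda>x. 0) at_top)" if "a = 0 \<and> b = 0"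
  proof -
    have eq: "p y2 = p y1" if "y1 < y2" for y1 y2
      using upper[OF that] lower[OF that] \<open>a = 0 \<and> b = 0\<close> by (simp add: zero_ereal_def)
    have "p y = p 0" for y using eq[of y 0] eq[of 0 y] by (cases y "0::real" rule: linorder_cases) auto
    then obtain p0 where p0: "p = (\<lambda>y. p0)" by blast
    have lim: "uniform_limit UNIV (\<lambda>t x. u (t, x) - p0) (\<lambda>x. 0) at_top"
      using main unfolding p0 .
    then have "uniform_limit UNIV (\<lambda>t x. u (t, x)) (\<lambda>x. p0) at_top"
      unfolding uniform_limit_iff dist_real_def by simp
    then show ?thesis using lim unfolding p0 by blast
  qed
  show ?thesis using p main Lip c const by blast
qed

end
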